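(* Let $\mathfrak{L}=\mathfrak{sl}_2\otimes_{\mathbb{C}}\mathbb{C}[t]/(t^2)$ be the Takiff Lie algebra of $\mathfrak{sl}_2$, and let $C,\overline{C}\in U(\mathfrak{L})$ be the central elements defined in the context. Let $\theta,\chi\in\mathbb{C}$ be such that $\theta\neq 0$ or $\chi\neq 0$. Then the algebra $U(\mathfrak{L})/(C-\theta,\overline{C}-\chi)$ is simple, where $(C-\theta,\overline{C}-\chi)$ denotes the two-sided ideal of $U(\mathfrak{L})$ generated by $C-\theta$ and $\overline{C}-\chi$.
   Context: All vector spaces and algebras are over $\mathbb{C}$. $\mathfrak{sl}_2$ has standard basis $e,h,f$ with $[e,f]=h$, $[h,e]=2e$, $[h,f]=-2f$. The Takiff Lie algebra is $\mathfrak{L}=\mathfrak{sl}_2\otimes_{\mathbb{C}}D$, $D=\mathbb{C}[t]/(t^2)$, with bracket $[x\otimes t^i,y\otimes t^j]=[x,y]\otimes t^{i+j}$. We identify $\mathfrak{sl}_2$ with $\mathfrak{sl}_2\otimes 1$ and set $\overline{e}=e\otimes t$, $\overline{f}=f\otimes t$, $\overline{h}=h\otimes t$. The center of the universal enveloping algebra $U(\mathfrak{L})$ is the polynomial algebra in the two central elements $$C=\overline{h}h+2\overline{f}e+2\overline{e}f,\qquad \overline{C}=\overline{h}^2+4\overline{f}\,\overline{e}.$$ *)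

theory Defs
  imports
    "HOL-Analysis.Analysis"
    "HOL-Library.Poly_Mapping"
    "HOL-Algebra.QuotRing"
    "HOL-Algebra.Algebraic_Closure_Type"
begin

section \<open>Free associative algebras over the complex numbers\<close>

text \<open>
  The free algebra on a type of letters is the monoid algebra of the free monoid: finitely
  supported functions on words, with the convolution product of \<^theory>\<open>HOL-Library.Poly_Mapping\<close>.
  That theory takes the monoid from the class \<^class>\<open>monoid_add\<close>, so concatenation of words is
  written \<open>+\<close> and the empty word \<open>0\<close>.
\<close>

datatype 'a word = Word (letters: "'a list")

instantiation word :: (type) monoid_add
begin

definition zero_word :: "'a word" where
  "zero_word = Word []"

definition plus_word :: "'a word \<Rightarrow> 'a word \<Rightarrow> 'a word" where
  "plus_word u v = Word (letters u @ letters v)"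

instance
  by standard (simp_all add: zero_word_def plus_word_def)

end

type_synonym 'a free_algebra = "'a word \<Rightarrow>\<^sub>0 complex"

definition gen :: "'a \<Rightarrow> 'a free_algebra" where
  "gen x = Poly_Mapping.single (Word [x]) 1"

definition scalar :: "complex \<Rightarrow> 'a free_algebra" where
  "scalar c = Poly_Mapping.single 0 c"

lemma ring_ring_of_type_algebra: "ring (ring_of_type_algebra :: 'a::ring_1 ring)"
proof -
  have "\<exists>y. x + y = 0" for x :: 'a
    using add.right_inverse by blast
  then show ?thesis
    unfolding ring_of_type_algebra_def using add.right_inverse
    by unfold_locales (auto simp: algebra_simps Units_def)
qed


section \<open>Universal enveloping algebras\<close>

text \<open>The space of the Lie algebra is a whole type; \<open>smul\<close> is its complex scalar
  multiplication.\<close>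

locale complex_lie_algebra = vector_space smul
  for smul :: "complex \<Rightarrow> 'l::ab_group_add \<Rightarrow> 'l" +
  fixes bracket :: "'l \<Rightarrow> 'l \<Rightarrow> 'l"
  assumes bracket_add_left: "bracket (x + y) z = bracket x z + bracket y z"
    and bracket_add_right: "bracket x (y + z) = bracket x y + bracket x z"
    and bracket_scale_left: "bracket (smul c x) y = smul c (bracket x y)"
    and bracket_scale_right: "bracket x (smul c y) = smul c (bracket x y)"
    and bracket_self: "bracket x x = 0"
    and jacobi: "bracket x (bracket y z) + bracket y (bracket z x) + bracket z (bracket x y) = 0"

text \<open>
  Every element of the Lie algebra is a letter. Modulo the first two families of relations the
  free algebra becomes the tensor algebra; the third family is
  \<open>x \<otimes> y - y \<otimes> x - [x, y]\<close>.
\<close>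

definition enveloping_relations ::
    "(complex \<Rightarrow> 'l::ab_group_add \<Rightarrow> 'l) \<Rightarrow> ('l \<Rightarrow> 'l \<Rightarrow> 'l) \<Rightarrow> 'l free_algebra set" where
  "enveloping_relations smul bracket =
     {gen (x + y) - gen x - gen y | x y. True} \<union>
     {gen (smul c x) - scalar c * gen x | c x. True} \<union>
     {gen x * gen y - gen y * gen x - gen (bracket x y) | x y. True}"

definition enveloping_ideal ::
    "(complex \<Rightarrow> 'l::ab_group_add \<Rightarrow> 'l) \<Rightarrow> ('l \<Rightarrow> 'l \<Rightarrow> 'l) \<Rightarrow> 'l free_algebra set" where
  "enveloping_ideal smul bracket =
     Idl\<^bsub>ring_of_type_algebra\<^esub> (enveloping_relations smul bracket)"

definition enveloping_algebra ::
    "(complex \<Rightarrow> 'l::ab_group_add \<Rightarrow> 'l) \<Rightarrow> ('l \<Rightarrow> 'l \<Rightarrow> 'l) \<Rightarrow> 'l free_algebra set ring" where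
  "enveloping_algebra smul bracket =
     ring_of_type_algebra Quot (enveloping_ideal smul bracket)"

definition enveloping_class ::
    "(complex \<Rightarrow> 'l::ab_group_add \<Rightarrow> 'l) \<Rightarrow> ('l \<Rightarrow> 'l \<Rightarrow> 'l) \<Rightarrow> 'l free_algebra \<Rightarrow> 'l free_algebra set"
  where
  "enveloping_class smul bracket p =
     enveloping_ideal smul bracket +>\<^bsub>ring_of_type_algebra\<^esub> p"

lemma ideal_enveloping_ideal:
  "ideal (enveloping_ideal smul bracket) ring_of_type_algebra"
  unfolding enveloping_ideal_def
  by (rule ring.genideal_ideal[OF ring_ring_of_type_algebra]) (simp add: ring_of_type_algebra_def)

lemma ring_enveloping_algebra: "ring (enveloping_algebra smul bracket)"
  unfolding enveloping_algebra_def by (rule ideal.quotient_is_ring[OF ideal_enveloping_ideal])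

lemma enveloping_class_ring_hom:
  "enveloping_class smul bracket \<in> ring_hom ring_of_type_algebra (enveloping_algebra smul bracket)"
  unfolding enveloping_class_def[abs_def] enveloping_algebra_def
  by (rule ideal.rcos_ring_hom[OF ideal_enveloping_ideal])


section \<open>The Takiff Lie algebra of sl2\<close>

text \<open>A vector \<open>(a, b, c)\<close> stands for \<open>a e + b h + c f\<close>.\<close>

type_synonym sl2 = "complex ^ 3"

definition sl2_e :: sl2 where "sl2_e = vector [1, 0, 0]"
definition sl2_h :: sl2 where "sl2_h = vector [0, 1, 0]"
definition sl2_f :: sl2 where "sl2_f = vector [0, 0, 1]"

definition sl2_bracket :: "sl2 \<Rightarrow> sl2 \<Rightarrow> sl2" where
  "sl2_bracket x y = vector
     [2 * (x $ 2 * y $ 1 - x $ 1 * y $ 2),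
      x $ 1 * y $ 3 - x $ 3 * y $ 1,
      2 * (x $ 3 * y $ 2 - x $ 2 * y $ 3)]"

lemma sl2_bracket_basis:
  "sl2_bracket sl2_e sl2_f = sl2_h"
  "sl2_bracket sl2_h sl2_e = 2 *s sl2_e"
  "sl2_bracket sl2_h sl2_f = (-2) *s sl2_f"
  by (simp_all add: sl2_bracket_def sl2_e_def sl2_h_def sl2_f_def vec_eq_iff forall_3)

lemma complex_lie_algebra_sl2: "complex_lie_algebra ((*s) :: complex \<Rightarrow> sl2 \<Rightarrow> sl2) sl2_bracket"
  by unfold_locales (simp_all add: sl2_bracket_def vec_eq_iff forall_3 algebra_simps)

text \<open>
  In terms of the basis \<open>1, t\<close> of \<open>D\<close>, a pair \<open>(x, y)\<close> stands for
  \<open>x \<otimes> 1 + y \<otimes> t\<close>.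
\<close>

type_synonym takiff = "sl2 \<times> sl2"

definition takiff_scale :: "complex \<Rightarrow> takiff \<Rightarrow> takiff" where
  "takiff_scale c u = (c *s fst u, c *s snd u)"

definition takiff_bracket :: "takiff \<Rightarrow> takiff \<Rightarrow> takiff" where
  "takiff_bracket u v =
     (sl2_bracket (fst u) (fst v), sl2_bracket (fst u) (snd v) + sl2_bracket (snd u) (fst v))"

text \<open>The pure tensor \<open>x \<otimes> p\<close>, for \<open>p\<close> a polynomial representing an element of
  \<open>\<complex>[t]/(t\<^sup>2)\<close>.\<close>

definition takiff_tensor :: "sl2 \<Rightarrow> complex poly \<Rightarrow> takiff" where
  "takiff_tensor x p = (poly.coeff p 0 *s x, poly.coeff p 1 *s x)"

lemma takiff_tensor_cong:
  "[:0, 0, 1:] dvd p - q \<Longrightarrow> takiff_tensor x p = takiff_tensor x q"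
proof (elim dvdE)
  fix r assume "p - q = [:0, 0, 1:] * r"
  then have "p = q + pCons 0 (pCons 0 r)"
    by (simp add: algebra_simps)
  then show ?thesis
    by (simp add: takiff_tensor_def)
qed

lemma takiff_tensor_decomposition:
  "u = takiff_tensor (fst u) 1 + takiff_tensor (snd u) [:0, 1:]"
  by (simp add: takiff_tensor_def prod_eq_iff)

lemma takiff_bracket_tensor:
  "takiff_bracket (takiff_tensor x p) (takiff_tensor y q) = takiff_tensor (sl2_bracket x y) (p * q)"
  by (simp add: takiff_bracket_def takiff_tensor_def sl2_bracket_def Polynomial.coeff_mult vec_eq_iff
      forall_3 algebra_simps)

lemma complex_lie_algebra_takiff: "complex_lie_algebra takiff_scale takiff_bracket"
  by unfold_locales
    (simp_all add: takiff_bracket_def takiff_scale_def sl2_bracket_def prod_eq_iff vec_eq_iff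
      forall_3 algebra_simps)

abbreviation U_takiff :: "takiff free_algebra set ring" where
  "U_takiff \<equiv> enveloping_algebra takiff_scale takiff_bracket"

abbreviation U_class :: "takiff free_algebra \<Rightarrow> takiff free_algebra set" where
  "U_class \<equiv> enveloping_class takiff_scale takiff_bracket"

definition casimir :: "takiff free_algebra set" where
  "casimir =
    (let e = gen (takiff_tensor sl2_e 1); e' = gen (takiff_tensor sl2_e [:0, 1:]);
         h = gen (takiff_tensor sl2_h 1); h' = gen (takiff_tensor sl2_h [:0, 1:]);
         f = gen (takiff_tensor sl2_f 1); f' = gen (takiff_tensor sl2_f [:0, 1:])
     in U_class (h' * h + 2 * f' * e + 2 * e' * f))"

definition casimir_bar :: "takiff free_algebra set" where
  "casimir_bar =
    (let e' = gen (takiff_tensor sl2_e [:0, 1:]);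
         h' = gen (takiff_tensor sl2_h [:0, 1:]);
         f' = gen (takiff_tensor sl2_f [:0, 1:])
     in U_class (h' ^ 2 + 4 * f' * e'))"


section \<open>Simple algebras\<close>

text \<open>Two-sided ring ideals of a unital algebra are closed under scalars, so for the
  underlying ring of a unital algebra this is simplicity as an algebra.\<close>

definition simple_ring :: "('a, 'b) ring_scheme \<Rightarrow> bool" where
  "simple_ring R \<longleftrightarrow>
     ring R \<and> \<one>\<^bsub>R\<^esub> \<noteq> \<zero>\<^bsub>R\<^esub> \<and>
     (\<forall>I. ideal I R \<longrightarrow> I = {\<zero>\<^bsub>R\<^esub>} \<or> I = carrier R)"

end

theory Submission
  imports Defs
begin

text \<open>
  Write \<open>E\<close>, \<open>H\<close>, \<open>G\<close> for the elements \<open>e \<otimes> t\<close>, \<open>h \<otimes> t\<close>, \<open>f \<otimes> t\<close> of the enveloping algebra \<open>U\<close>, and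
  call an ideal admissible if it contains \<open>C - \<theta>\<close> and \<open>C' - \<chi>\<close>, where \<open>C\<close> and \<open>C' = H\<^sup>2 + 4 G E\<close> are the
  two central elements. Simplicity of the quotient says that the smallest admissible ideal \<open>K\<close> is
  proper and that an admissible ideal without \<open>1\<close> is contained in \<open>K\<close>. Everything turns on the element
  \<open>E\<close>, and works as if the quotient were already localised at \<open>E\<close>, where it becomes an algebra of
  differential operators in two variables.

  A power of \<open>E\<close> generates the unit ideal (\<open>E_power_imp_one\<close>). Commuting \<open>E\<^sup>m\<^sup>+\<^sup>1\<close> with \<open>f\<close> twice gives
  \<open>H E\<^sup>m\<close> and then a combination of \<open>G E\<^sup>m\<close> and \<open>H\<^sup>2 E\<^sup>m\<^sup>-\<^sup>1\<close>, in which \<open>C' = \<chi>\<close> eliminates \<open>H\<^sup>2\<close>. If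
  \<open>\<chi> \<noteq> 0\<close> a further factor \<open>E\<close> yields \<open>E\<^sup>m\<close>. If \<open>\<chi> = 0\<close> the combination is a multiple of \<open>G E\<^sup>m\<close>, and then
  \<open>\<theta> E\<^sup>m = C E\<^sup>m = h H E\<^sup>m + 2 e G E\<^sup>m + 2 f E\<^sup>m\<^sup>+\<^sup>1\<close> is in the ideal as well. In geometric terms, the
  \<open>sl2\<close>-translates of \<open>E\<close> have no common zero on the quadric \<open>C' = \<chi>\<close> if \<open>\<chi> \<noteq> 0\<close>, and only the origin
  if \<open>\<chi> = 0\<close>, where the symbol of \<open>C\<close> vanishes while \<open>\<theta>\<close> does not.

  Consequently admissible ideals have no \<open>E\<close>-torsion (\<open>E_torsion_free\<close>): if \<open>E\<^sup>N x \<in> I\<close>, the left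
  annihilator modulo \<open>I\<close> of the iterated commutators of \<open>x\<close> with \<open>f\<close> contains a power of \<open>E\<close>, because
  only finitely many of these are nonzero; hence it contains \<open>1\<close>, and \<open>x \<in> I\<close>.

  Multiplied by powers of \<open>E\<close>, the elements \<open>G\<close> and \<open>f\<close> can be expressed through \<open>E\<close>, \<open>H\<close>, \<open>h\<close>, \<open>e\<close> by
  means of \<open>C' = \<chi>\<close> and \<open>C = \<theta>\<close>. So for every \<open>x\<close> some \<open>E\<^sup>n x\<close> is, modulo \<open>K\<close>, a combination of monomials
  in these four elements (\<open>normal_form\<close>). The commutators with \<open>H\<close>, \<open>E\<close>, \<open>e\<close>, \<open>h\<close> lower the exponents of
  \<open>e\<close>, \<open>h\<close>, \<open>H\<close>, \<open>E\<close> one by one, at the price of a left factor \<open>E\<close>, which torsion-freeness cancels; so if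
  such a combination lies in an admissible ideal without \<open>1\<close>, then all its coefficients are zero
  (\<open>ladder_span_ideal\<close>, \<open>borel_poly_inter_ideal\<close>). Thus \<open>E\<^sup>n x \<in> K\<close>, and \<open>x \<in> K\<close> by torsion-freeness
  (\<open>proper_ideal_subset\<close>).

  Finally \<open>K\<close> is proper, since the differential operators mentioned above act on two-sided formal series in
  two variables, a nonzero module on which \<open>C\<close> and \<open>C'\<close> act as \<open>\<theta>\<close> and \<open>\<chi>\<close>
  (\<open>takiff_op_bracket\<close>, \<open>casimir_annihilator\<close>).
\<close>

section \<open>Ideals of a ring\<close>

definition left_ideal :: "'a::ring_1 set \<Rightarrow> bool" where
  "left_ideal J \<longleftrightarrow> 0 \<in> J \<and> (\<forall>x\<in>J. \<forall>y\<in>J. x + y \<in> J) \<and> (\<forall>x\<in>J. \<forall>a. a * x \<in> J)"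

definition two_sided_ideal :: "'a::ring_1 set \<Rightarrow> bool" where
  "two_sided_ideal I \<longleftrightarrow> left_ideal I \<and> (\<forall>x\<in>I. \<forall>a. x * a \<in> I)"

lemma left_ideal_0: "left_ideal J \<Longrightarrow> 0 \<in> J"
  and left_ideal_add: "left_ideal J \<Longrightarrow> x \<in> J \<Longrightarrow> y \<in> J \<Longrightarrow> x + y \<in> J"
  and left_ideal_mult: "left_ideal J \<Longrightarrow> x \<in> J \<Longrightarrow> a * x \<in> J"
  by (auto simp: left_ideal_def)

lemma left_ideal_uminus: "left_ideal J \<Longrightarrow> x \<in> J \<Longrightarrow> - x \<in> J"
  using left_ideal_mult[of J x "- 1"] by simp

lemma left_ideal_diff: "left_ideal J \<Longrightarrow> x \<in> J \<Longrightarrow> y \<in> J \<Longrightarrow> x - y \<in> J"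
  using left_ideal_add[of J x "- y"] left_ideal_uminus[of J y] by simp

lemma left_ideal_sum: "left_ideal J \<Longrightarrow> (\<And>i. i \<in> A \<Longrightarrow> x i \<in> J) \<Longrightarrow> sum x A \<in> J"
  by (induction A rule: infinite_finite_induct) (auto simp: left_ideal_0 left_ideal_add)

lemma two_sided_ideal_imp_left: "two_sided_ideal I \<Longrightarrow> left_ideal I"
  and two_sided_ideal_mult_right: "two_sided_ideal I \<Longrightarrow> x \<in> I \<Longrightarrow> x * a \<in> I"
  by (auto simp: two_sided_ideal_def)

section \<open>Generators, relations and central elements\<close>

text \<open>
  The capital letters \<open>E, H, G\<close> stand for \<open>e \<otimes> t, h \<otimes> t, f \<otimes> t\<close>. Each bracket is written as a rule that moves one letter past another.
\<close>
locale takiff_generators =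
  fixes sc :: "complex \<Rightarrow> 'a::ring_1" and e h f E H G :: 'a
  assumes sc_1: "sc 1 = 1"
    and sc_add: "sc (a + b) = sc a + sc b"
    and sc_mult: "sc (a * b) = sc a * sc b"
    and sc_central: "x * sc a = sc a * x"
    and ef: "e * f = f * e + h"
    and he: "h * e = e * h + 2 * e"
    and hf: "h * f = f * h - 2 * f"
    and eE: "e * E = E * e"
    and eH: "e * H = H * e - 2 * E"
    and eG: "e * G = G * e + H"
    and hE: "h * E = E * h + 2 * E"
    and hH: "h * H = H * h"
    and hG: "h * G = G * h - 2 * G"
    and Ef: "E * f = f * E + H"
    and Hf: "H * f = f * H - 2 * G"
    and Gf: "G * f = f * G"
    and HE: "H * E = E * H"
    and GE: "G * E = E * G"
    and GH: "G * H = H * G"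
begin

definition cas :: 'a where "cas = H * h + 2 * G * e + 2 * E * f"
definition cas_bar :: 'a where "cas_bar = H ^ 2 + 4 * G * E"

text \<open>
  With the Lie algebra elements on the left, the central element can be applied to products that
  start with \<open>H\<close>, \<open>G\<close>, \<open>E\<close> inside a left ideal. The corrections \<open>- 2 H\<close> and \<open>2 H\<close> cancel.
\<close>
lemma cas_alt: "cas = h * H + 2 * (e * G) + 2 * (f * E)"
  by (simp add: cas_def mult.assoc Ef eG hH algebra_simps)

lemma sc_0: "sc 0 = 0"
  using sc_add[of 0 0] by simp

lemma sc_minus: "sc (- a) = - sc a"
  using sc_add[of a "- a"] by (simp add: sc_0 eq_neg_iff_add_eq_0 add.commute)

lemma sc_of_nat: "sc (of_nat n) = of_nat n"
  by (induction n) (simp_all add: sc_0 sc_add sc_1)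

lemma left_ideal_sc_cancel:
  fixes x :: 'a
  assumes "left_ideal J" "sc c * x \<in> J" "c \<noteq> 0"
  shows "x \<in> J"
proof -
  have "sc (1 / c) * sc c = 1"
    using assms(3) sc_mult[of "1 / c" c] by (simp add: sc_1)
  then have "x = sc (1 / c) * (sc c * x)"
    by (simp flip: mult.assoc)
  then show ?thesis
    using left_ideal_mult[OF assms(1,2), of "sc (1 / c)"] by simp
qed

lemma left_ideal_of_nat_cancel:
  fixes x :: 'a
  assumes "left_ideal J" "of_nat n * x \<in> J" "n \<noteq> 0"
  shows "x \<in> J"
  using left_ideal_sc_cancel[of J "of_nat n" x] assms by (simp add: sc_of_nat)

lemma of_nat_commute: "x * of_nat n = of_nat n * (x :: 'a)"
  by (simp flip: sc_of_nat add: sc_central)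

lemma E_power_f: "E ^ Suc n * f = f * E ^ Suc n + of_nat (Suc n) * (H * E ^ n)"
proof (induction n)
  case 0
  then show ?case by (simp add: Ef)
next
  case (Suc n)
  have "E ^ Suc (Suc n) * f = E * (E ^ Suc n * f)"
    by (simp add: mult.assoc)
  also have "\<dots> = (E * f) * E ^ Suc n + of_nat (Suc n) * (E * H * E ^ n)"
    unfolding Suc by (simp only: distrib_left mult.assoc of_nat_commute)
      (metis mult.assoc of_nat_commute)
  also have "\<dots> = f * E ^ Suc (Suc n) + of_nat (Suc (Suc n)) * (H * E ^ Suc n)"
    by (simp add: Ef algebra_simps flip: HE)
  finally show ?case .
qed

section \<open>Powers of \<open>E\<close> generate the unit ideal\<close>

text \<open>
  One step lowers the exponent of \<open>E\<close> by one. The ideal is only required to be a left ideal closed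
  under right multiplication by \<open>f\<close>, because commutators with \<open>f\<close> are the only use of the right side,
  and because the annihilators to which the lemma will be applied have no more structure than that.
\<close>
lemma E_power_imp_one:
  assumes J: "left_ideal J" and Jf: "\<And>x. x \<in> J \<Longrightarrow> x * f \<in> J"
    and cas: "\<And>y. (cas - sc theta) * y \<in> J" and cas_bar: "\<And>y. (cas_bar - sc chi) * y \<in> J"
    and nz: "theta \<noteq> 0 \<or> chi \<noteq> 0"
    and pow: "E ^ k \<in> J"
  shows "1 \<in> J"
proof -
  note cl = left_ideal_add[OF J] left_ideal_diff[OF J] left_ideal_mult[OF J] left_ideal_uminus[OF J]
  have cas_mem: "sc theta * y \<in> J" if "h * H * y \<in> J" "e * G * y \<in> J" "f * E * y \<in> J" for y
  proof -
    have "sc theta * y = h * H * y + of_nat 2 * (e * G * y) + of_nat 2 * (f * E * y) - (cas - sc theta) * y"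
      by (simp add: cas_alt algebra_simps)
    then show ?thesis
      using that cas[of y] cl by metis
  qed
  have step: "E ^ m \<in> J" if Em: "E ^ Suc m \<in> J" for m
  proof -
    have H: "H * E ^ m \<in> J"
    proof -
      have "of_nat (Suc m) * (H * E ^ m) = E ^ Suc m * f - f * E ^ Suc m"
        by (simp only: E_power_f) simp
      also have "\<dots> \<in> J" using Em Jf cl by blast
      finally show ?thesis using left_ideal_of_nat_cancel[OF J] by blast
    qed
    \<comment> \<open>The commutator of \<open>H E\<^sup>m\<close> with \<open>f\<close> is \<open>m H\<^sup>2 E\<^sup>m\<^sup>-\<^sup>1 - 2 G E\<^sup>m\<close>; the first term is
        absent if \<open>m = 0\<close>.\<close>
    then have Y: "H * E ^ m * f - f * (H * E ^ m) \<in> J" using Jf cl by blast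
    show ?thesis
    proof (cases m)
      case 0
      have "of_nat 2 * G \<in> J"
        using Y cl(4)[OF Y] by (simp add: 0 Hf)
      then have G: "G \<in> J" using left_ideal_of_nat_cancel[OF J, of 2] by simp
      show ?thesis
      proof (cases "chi = 0")
        case True
        with nz have "theta \<noteq> 0" by simp
        have "sc theta * 1 \<in> J"
          using G H Em by (intro cas_mem) (simp_all add: 0 cl)
        then show ?thesis
          using left_ideal_sc_cancel[OF J _ \<open>theta \<noteq> 0\<close>] by (simp add: 0)
      next
        case False
        have "H * H + 4 * G * E - (cas_bar - sc chi) * 1 \<in> J"
          using H Em by (intro cl cas_bar) (simp_all add: 0)
        also have "H * H + 4 * G * E - (cas_bar - sc chi) * 1 = sc chi * 1"
          by (simp add: cas_bar_def power2_eq_square)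
        finally show ?thesis
          using left_ideal_sc_cancel[OF J _ False] by (simp add: 0)
      qed
    next
      case (Suc p)
      have "H * E ^ m * f - f * (H * E ^ m) = of_nat m * (H * H * E ^ p) - of_nat 2 * (G * E ^ m)"
      proof -
        have "H * E ^ m * f = H * (f * E ^ m + of_nat m * (H * E ^ p))"
          unfolding Suc by (simp only: mult.assoc E_power_f)
        also have "\<dots> = (H * f) * E ^ m + of_nat m * (H * H * E ^ p)"
          by (simp only: distrib_left mult.assoc) (metis mult.assoc of_nat_commute)
        finally show ?thesis by (simp add: Hf algebra_simps)
      qed
      \<comment> \<open>Replacing \<open>H\<^sup>2\<close> by \<open>chi - 4 G E\<close> leaves only \<open>E\<^sup>m\<^sup>-\<^sup>1\<close> and \<open>G E\<^sup>m\<close>.\<close>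
      also have "\<dots> - of_nat m * ((cas_bar - sc chi) * E ^ p) 
          = of_nat m * (sc chi * E ^ p) - of_nat (4 * m + 2) * (G * E ^ m)"
      proof -
        have "G * E * E ^ p = G * E ^ m" by (simp add: Suc mult.assoc)
        then have "(cas_bar - sc chi) * E ^ p = H * H * E ^ p + 4 * (G * E ^ m) - sc chi * E ^ p"
          by (simp add: cas_bar_def power2_eq_square algebra_simps mult_2)
        then show ?thesis by (simp add: algebra_simps mult_2)
      qed
      finally have Z: "of_nat m * (sc chi * E ^ p) - of_nat (4 * m + 2) * (G * E ^ m) \<in> J"
        using Y cl cas_bar[of "E ^ p"] by metis
      show ?thesis
      proof (cases "chi = 0")
        case True
        with nz have "theta \<noteq> 0" by simp
        have "of_nat (4 * m + 2) * (G * E ^ m) \<in> J"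
          using cl(4)[OF Z] by (simp add: True sc_0)
        then have G: "G * E ^ m \<in> J" using left_ideal_of_nat_cancel[OF J, of "4 * m + 2"] by simp
        have "sc theta * E ^ m \<in> J"
          using G H Em by (intro cas_mem) (simp_all add: mult.assoc cl)
        then show ?thesis
          using left_ideal_sc_cancel[OF J _ \<open>theta \<noteq> 0\<close>] by simp
      next
        case False
        \<comment> \<open>A further factor \<open>E\<close> puts the \<open>G\<close>-term into \<open>J\<close>, since \<open>E\<^sup>m\<^sup>+\<^sup>1\<close> is there.\<close>
        have "E * (of_nat m * (sc chi * E ^ p) - of_nat (4 * m + 2) * (G * E ^ m))
          + of_nat (4 * m + 2) * (G * E ^ Suc m) \<in> J"
          by (rule cl(1)[OF cl(3)[OF Z] cl(3)[OF cl(3)[OF Em]]])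
        also have "E * (of_nat m * (sc chi * E ^ p) - of_nat (4 * m + 2) * (G * E ^ m))
          + of_nat (4 * m + 2) * (G * E ^ Suc m) = of_nat m * (sc chi * E ^ m)"
        proof -
          have "E * (of_nat m * (sc chi * E ^ p)) = of_nat m * (sc chi * E ^ m)"
            unfolding Suc by (metis mult.assoc of_nat_commute sc_central power_Suc)
          moreover have "E * (of_nat k * (G * E ^ m)) = of_nat k * (G * E ^ Suc m)" for k
            by (metis mult.assoc of_nat_commute GE power_Suc)
          ultimately show ?thesis by (simp only: right_diff_distrib diff_add_cancel)
        qed
        finally show ?thesis
          by (rule left_ideal_sc_cancel[OF J left_ideal_of_nat_cancel[OF J] False]) (simp add: Suc)
      qed
    qed
  qed
  from pow show ?thesis
    by (induction k) (use step in auto)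
qed

section \<open>Admissible ideals have no \<open>E\<close>-torsion\<close>

definition ad_f :: "'a \<Rightarrow> 'a" where "ad_f x = f * x - x * f"

lemma ad_f_mult: "ad_f (x * y) = ad_f x * y + x * ad_f y"
  by (simp add: ad_f_def algebra_simps)

lemma ad_f_pow_0: "(ad_f ^^ n) 0 = 0"
  by (induction n) (simp_all add: ad_f_def)

lemma ad_f_pow_add: "(ad_f ^^ n) (x + y) = (ad_f ^^ n) x + (ad_f ^^ n) y"
  by (induction n) (simp_all add: ad_f_def algebra_simps)

text \<open>
  The Leibniz rule in its qualitative form. It makes the elements on which \<open>ad_f\<close> is nilpotent a
  subring.
\<close>
lemma ad_f_pow_mult_eq_0:
  "(ad_f ^^ a) x = 0 \<Longrightarrow> (ad_f ^^ b) y = 0 \<Longrightarrow> (ad_f ^^ (a + b)) (x * y) = 0"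
proof (induction "a + b" arbitrary: a b x y)
  case 0
  then show ?case by simp
next
  case (Suc n)
  show ?case
  proof (cases "a = 0 \<or> b = 0")
    case True
    then show ?thesis using Suc.prems by (auto simp: ad_f_pow_0)
  next
    case False
    then obtain a' b' where ab: "a = Suc a'" "b = Suc b'" by (meson not0_implies_Suc)
    have "(ad_f ^^ Suc (a' + b')) (ad_f x * y) = 0" "(ad_f ^^ Suc (a' + b')) (x * ad_f y) = 0"
      using Suc.hyps(1)[of a' b "ad_f x" y] Suc.hyps(1)[of a b' x "ad_f y"] Suc.prems Suc.hyps(2) ab
      by (simp_all add: funpow_swap1)
    moreover have "(ad_f ^^ (a + b)) (x * y)
        = (ad_f ^^ Suc (a' + b')) (ad_f x * y) + (ad_f ^^ Suc (a' + b')) (x * ad_f y)"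
      unfolding ab add_Suc add_Suc_right funpow_Suc_right[of "Suc (a' + b')"] comp_apply ad_f_mult
      by (rule ad_f_pow_add)
    ultimately show ?thesis by simp
  qed
qed

lemma ad_f_pow_le_0: "(ad_f ^^ a) x = 0 \<Longrightarrow> a \<le> n \<Longrightarrow> (ad_f ^^ n) x = 0"
  by (metis ad_f_pow_0 le_add_diff_inverse2 comp_apply funpow_add)

lemma ad_f_nilpotent_mult:
  "(\<exists>n. (ad_f ^^ n) x = 0) \<Longrightarrow> (\<exists>n. (ad_f ^^ n) y = 0) \<Longrightarrow> (\<exists>n. (ad_f ^^ n) (x * y) = 0)"
  using ad_f_pow_mult_eq_0 by blast

lemma ad_f_nilpotent_add:
  assumes "\<exists>n. (ad_f ^^ n) x = 0" "\<exists>n. (ad_f ^^ n) y = 0"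
  shows "\<exists>n. (ad_f ^^ n) (x + y) = 0"
proof -
  obtain a b where "(ad_f ^^ a) x = 0" "(ad_f ^^ b) y = 0" using assms by blast
  then have "(ad_f ^^ (a + b)) (x + y) = 0"
    by (simp add: ad_f_pow_add ad_f_pow_le_0)
  then show ?thesis by blast
qed

lemma ad_f_gen:
  "ad_f e = - h" "ad_f h = 2 * f" "ad_f f = 0" "ad_f E = - H" "ad_f H = 2 * G" "ad_f G = 0" "ad_f 0 = 0"
  by (simp_all add: ad_f_def ef hf Ef Hf Gf)

lemma ad_f_double: "ad_f (2 * x) = 2 * ad_f x" and ad_f_minus: "ad_f (- x) = - ad_f x"
  by (simp_all add: ad_f_def algebra_simps mult_2)

lemma ad_f_nilpotent_generators:
  assumes "g \<in> {e, h, f, E, H, G}"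
  shows "\<exists>n. (ad_f ^^ n) g = 0"
proof -
  have "(ad_f ^^ 3) g = 0"
    using assms by (auto simp: numeral_3_eq_3 ad_f_gen ad_f_double ad_f_minus)
  then show ?thesis by blast
qed

text \<open>
  The elements killed by powers of \<open>E\<close> modulo \<open>I\<close> form a space stable under \<open>ad_f\<close>. As \<open>ad_f\<close> is
  nilpotent on \<open>x\<close>, one power of \<open>E\<close> kills all \<open>M i\<close>, the iterated commutators of \<open>x\<close>. Their common left
  annihilator \<open>J\<close> modulo \<open>I\<close> then contains \<open>1\<close> by the previous section.
\<close>
lemma E_torsion_free:
  assumes I: "two_sided_ideal I"
    and cas: "cas - sc theta \<in> I" and cas_bar: "cas_bar - sc chi \<in> I"
    and nz: "theta \<noteq> 0 \<or> chi \<noteq> 0"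
    and x: "\<exists>n. (ad_f ^^ n) x = 0"
    and tors: "E ^ N * x \<in> I"
  shows "x \<in> I"
proof -
  note L = two_sided_ideal_imp_left[OF I]
  note cl = left_ideal_add[OF L] left_ideal_diff[OF L] left_ideal_mult[OF L]
    left_ideal_0[OF L] two_sided_ideal_mult_right[OF I]
  define M where "M i = (ad_f ^^ i) x" for i
  have M_f: "f * M i = M (Suc i) + M i * f" for i
    by (simp add: M_def ad_f_def)
  \<comment> \<open>Each commutator with \<open>f\<close> costs one more factor \<open>E\<close>.\<close>
  have tors_M: "E ^ (N + i) * M i \<in> I" for i
  proof (induction i)
    case 0
    then show ?case using tors by (simp add: M_def)
  next
    case (Suc i)
    let ?n = "N + i"
    have "E ^ Suc ?n * M (Suc i) = (E ^ Suc ?n * f) * M i - E ^ Suc ?n * M i * f"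
      using M_f[of i] by (simp add: algebra_simps)
    also have "\<dots> = f * (E * (E ^ ?n * M i)) + of_nat (Suc ?n) * (H * (E ^ ?n * M i)) - E * (E ^ ?n * M i) * f"
      unfolding E_power_f by (simp add: algebra_simps)
    also have "\<dots> \<in> I"
      by (rule cl(2)[OF cl(1)[OF cl(3)[OF cl(3)[OF Suc]] cl(3)[OF cl(3)[OF Suc]]] cl(5)[OF cl(3)[OF Suc]]])
    finally show ?case by simp
  qed
  obtain n where n: "M n = 0" using x by (auto simp: M_def)
  have M_0: "M i = 0" if "i \<ge> n" for i
    using n that by (auto simp: M_def intro: ad_f_pow_le_0)
  define J where "J = {a. \<forall>i. a * M i \<in> I}"
  have "left_ideal J"
    using cl(1,3,4) by (simp add: left_ideal_def J_def distrib_right mult.assoc)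
  \<comment> \<open>Right multiplication by \<open>f\<close> moves from one \<open>M i\<close> to the next, so it is essential that \<open>J\<close>
      annihilates all of them.\<close>
  moreover have "a * f \<in> J" if "a \<in> J" for a
  proof -
    have "a * f * M i = a * M (Suc i) + a * M i * f" for i
      by (simp only: mult.assoc M_f distrib_left)
    then show ?thesis using that cl(1,5) by (simp add: J_def)
  qed
  moreover have "(cas - sc theta) * y \<in> J" "(cas_bar - sc chi) * y \<in> J" for y
    using cas cas_bar cl(5) by (simp_all add: J_def)
  moreover have "E ^ (N + n) \<in> J"
  proof -
    have "E ^ (N + n) * M i \<in> I" for i
    proof (cases "i \<le> n")
      case True
      then have "E ^ (N + n) * M i = E ^ (n - i) * (E ^ (N + i) * M i)"
        by (simp add: add.commute flip: mult.assoc power_add)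
      then show ?thesis using tors_M cl(3) by simp
    next
      case False
      then show ?thesis using M_0 cl(4) by simp
    qed
    then show ?thesis by (simp add: J_def)
  qed
  ultimately have "1 \<in> J"
    using E_power_imp_one nz by blast
  then have "1 * M 0 \<in> I" by (simp only: J_def mem_Collect_eq)
  then show ?thesis by (simp add: M_def)
qed

section \<open>Ladders\<close>

text \<open>
  The right-hand factors \<open>s i\<close> play the role of coefficients: iterating the construction builds
  ordered polynomials in several noncommuting letters.
\<close>
definition ladder_span :: "(nat \<Rightarrow> 'a) \<Rightarrow> 'a set \<Rightarrow> 'a set" where
  "ladder_span b S = {\<Sum>i<n. b i * s i | n s. \<forall>i. s i \<in> S}"

definition scalar_subspace :: "'a set \<Rightarrow> bool" where
  "scalar_subspace S \<longleftrightarrow> 0 \<in> S \<and> (\<forall>x\<in>S. \<forall>y\<in>S. x + y \<in> S) \<and> (\<forall>x\<in>S. \<forall>c. sc c * x \<in> S)"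

lemma ladder_span_sumI: "(\<And>i. s i \<in> S) \<Longrightarrow> (\<Sum>i<n. b i * s i) \<in> ladder_span b S"
  unfolding ladder_span_def by blast

lemma scalar_subspace_ladder_span:
  assumes S: "scalar_subspace S"
  shows "scalar_subspace (ladder_span b S)"
proof -
  have add: "x + y \<in> ladder_span b S" if "x \<in> ladder_span b S" "y \<in> ladder_span b S" for x y
  proof -
    obtain n s where x: "x = (\<Sum>i<n. b i * s i)" "\<And>i. s i \<in> S"
      using \<open>x \<in> _\<close> by (auto simp: ladder_span_def)
    obtain m t where y: "y = (\<Sum>i<m. b i * t i)" "\<And>i. t i \<in> S"
      using \<open>y \<in> _\<close> by (auto simp: ladder_span_def)
    define u where "u i = (if i < n then s i else 0) + (if i < m then t i else 0)" for i
    have "x = (\<Sum>i<n + m. b i * (if i < n then s i else 0))"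
      unfolding x by (intro sum.mono_neutral_cong_left) auto
    moreover have "y = (\<Sum>i<n + m. b i * (if i < m then t i else 0))"
      unfolding y by (intro sum.mono_neutral_cong_left) auto
    ultimately have "x + y = (\<Sum>i<n + m. b i * u i)"
      by (simp only: u_def distrib_left sum.distrib)
    moreover have "u i \<in> S" for i
      using S x y by (auto simp: scalar_subspace_def u_def)
    ultimately show ?thesis by (simp add: ladder_span_sumI)
  qed
  have "sc c * x \<in> ladder_span b S" if "x \<in> ladder_span b S" for x c
  proof -
    obtain n s where x: "x = (\<Sum>i<n. b i * s i)" "\<And>i. s i \<in> S"
      using \<open>x \<in> _\<close> by (auto simp: ladder_span_def)
    have "sc c * (b i * s i) = b i * (sc c * s i)" for i
      by (metis mult.assoc sc_central)
    then have "sc c * x = (\<Sum>i<n. b i * (sc c * s i))"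
      by (simp only: x sum_distrib_left)
    moreover have "sc c * s i \<in> S" for i using S x by (auto simp: scalar_subspace_def)
    ultimately show ?thesis by (auto intro: ladder_span_sumI)
  qed
  moreover have "0 \<in> ladder_span b S"
    using S unfolding ladder_span_def scalar_subspace_def by (auto intro!: exI[of _ 0] exI[of _ "\<lambda>_. 0"])
  ultimately show ?thesis using add by (simp add: scalar_subspace_def)
qed

lemma ladder_spanI: "scalar_subspace S \<Longrightarrow> s \<in> S \<Longrightarrow> b i * s \<in> ladder_span b S"
  unfolding ladder_span_def scalar_subspace_def
  by (auto intro!: exI[of _ "Suc i"] exI[of _ "\<lambda>j. if j = i then s else 0"] simp: sum.delta)

lemma ladder_span_induct:
  assumes "x \<in> ladder_span b S" "P 0" "\<And>x y. P x \<Longrightarrow> P y \<Longrightarrow> P (x + y)" "\<And>i s. s \<in> S \<Longrightarrow> P (b i * s)"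
  shows "P x"
proof -
  obtain n s where x: "x = (\<Sum>i<n. b i * s i)" "\<And>i. s i \<in> S"
      using \<open>x \<in> _\<close> by (auto simp: ladder_span_def)
  show ?thesis unfolding x
    by (induction n) (use assms x in auto)
qed

text \<open>
  If the commutator with \<open>z\<close> takes \<open>b (j + 1)\<close> to a nonzero multiple of \<open>E * b j\<close>, then \<open>z\<close>
  differentiates \<open>\<Sum>j. b j * s j\<close> formally, up to a left factor \<open>E\<close> that can be cancelled. So an ideal that
  contains the sum contains, by induction on the length, all coefficients \<open>s j\<close>.
\<close>
lemma ladder_span_ideal:
  assumes I: "two_sided_ideal I" and sat: "\<And>x. E * x \<in> I \<Longrightarrow> x \<in> I"
    and K: "left_ideal K"
    and S: "scalar_subspace S" "S \<inter> I \<subseteq> K"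
    and b0: "b 0 = 1"
    and z: "\<And>s. s \<in> S \<Longrightarrow> z * s = s * z"
    and zb: "\<And>j. z * b (Suc j) = b (Suc j) * z + sc (c * of_nat (Suc j)) * (E * b j)"
    and c: "c \<noteq> 0"
  shows "ladder_span b S \<inter> I \<subseteq> K"
proof -
  note L = two_sided_ideal_imp_left[OF I]
  note cl = left_ideal_add[OF L] left_ideal_diff[OF L] left_ideal_mult[OF L]
    left_ideal_0[OF L] two_sided_ideal_mult_right[OF I]
  have coeff: "\<forall>i<n. s i \<in> I" if "\<forall>i. s i \<in> S" "(\<Sum>i<n. b i * s i) \<in> I" for n s
    using that
  proof (induction n arbitrary: s)
    case 0
    then show ?case by simp
  next
    case (Suc n)
    define x where "x = (\<Sum>i<Suc n. b i * s i)"
    define y where "y = (\<Sum>i<n. b i * (sc (c * of_nat (Suc i)) * s (Suc i)))"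
    have x_Suc: "x = s 0 + (\<Sum>i<n. b (Suc i) * s (Suc i))"
      unfolding x_def by (subst sum.lessThan_Suc_shift) (simp add: b0)
    have "z * (b (Suc i) * s (Suc i)) - b (Suc i) * s (Suc i) * z
        = E * (b i * (sc (c * of_nat (Suc i)) * s (Suc i)))" for i
    proof -
      have "z * (b (Suc i) * s (Suc i)) = (z * b (Suc i)) * s (Suc i)"
        by (simp only: mult.assoc)
      also have "\<dots> = b (Suc i) * (z * s (Suc i)) + sc (c * of_nat (Suc i)) * (E * b i) * s (Suc i)"
        by (simp only: zb distrib_right mult.assoc)
      also have "z * s (Suc i) = s (Suc i) * z" using z Suc.prems by blast
      finally show ?thesis
        by (metis (no_types, lifting) add_diff_cancel_left' mult.assoc sc_central)
    qed
    then have "z * x - x * z = E * y"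
      using z[of "s 0"] Suc.prems(1)
      by (simp add: x_Suc y_def algebra_simps sum_distrib_left sum_distrib_right flip: sum_subtractf)
    moreover have "x \<in> I" using Suc.prems(2) by (simp only: x_def)
    then have "z * x - x * z \<in> I" by (intro cl(2)[OF cl(3) cl(5)])
    ultimately have "y \<in> I" using sat by simp
    then have I_Suc: "\<forall>i<n. sc (c * of_nat (Suc i)) * s (Suc i) \<in> I"
      unfolding y_def using S(1) Suc.prems(1) by (intro Suc.IH) (auto simp: scalar_subspace_def)
    have c_Suc: "c * of_nat (Suc i) \<noteq> 0" for i using c by (simp del: of_nat_Suc)
    have s_Suc: "\<forall>i<n. s (Suc i) \<in> I"
      using left_ideal_sc_cancel[OF L _ c_Suc] I_Suc by blast
    \<comment> \<open>The constant coefficient is lost by differentiation, but is what remains of \<open>x\<close>.\<close>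
    have "(\<Sum>i<n. b (Suc i) * s (Suc i)) \<in> I"
      using s_Suc by (intro left_ideal_sum[OF L] cl(3)) auto
    then have "s 0 \<in> I"
      using Suc.prems(2) cl(2)[of x "\<Sum>i<n. b (Suc i) * s (Suc i)"] unfolding x_def[symmetric]
      by (simp add: x_Suc)
    with s_Suc show ?case by (auto simp: less_Suc_eq_0_disj)
  qed
  show ?thesis
  proof
    fix x assume "x \<in> ladder_span b S \<inter> I"
    then obtain n s where x: "x = (\<Sum>i<n. b i * s i)" "\<forall>i. s i \<in> S" and "x \<in> I"
      by (auto simp: ladder_span_def)
    then have "\<forall>i<n. s i \<in> K" using coeff[of s n] S(2) by auto
    then show "x \<in> K"
      unfolding x by (intro left_ideal_sum[OF K] left_ideal_mult[OF K]) auto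
  qed
qed

definition stable :: "'a \<Rightarrow> 'a set \<Rightarrow> bool" where
  "stable z S \<longleftrightarrow> (\<forall>s\<in>S. z * s \<in> S)"

lemma ladder_span_commute:
  assumes "\<And>j. z * b j = b j * z" "\<And>s. s \<in> S \<Longrightarrow> z * s = s * z" "x \<in> ladder_span b S"
  shows "z * x = x * z"
  using assms(3)
proof (rule ladder_span_induct)
  fix i s assume "s \<in> S"
  then show "z * (b i * s) = b i * s * z"
    using assms(1,2) by (metis mult.assoc)
qed (simp_all add: algebra_simps)

text \<open>
  It suffices to check stability on products; the three lemmas that follow cover the ways in which the
  letters act on ladders: diagonally, by raising the index, or by lowering it.
\<close>
lemma stable_ladder_spanI:
  assumes S: "scalar_subspace S" and "\<And>i s. s \<in> S \<Longrightarrow> z * (b i * s) \<in> ladder_span b S"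
  shows "stable z (ladder_span b S)"
  unfolding stable_def
proof
  fix x assume "x \<in> ladder_span b S"
  then show "z * x \<in> ladder_span b S"
    by (rule ladder_span_induct)
      (use assms scalar_subspace_ladder_span[OF S, of b] in \<open>auto simp: scalar_subspace_def distrib_left\<close>)
qed

lemma stable_ladder_span_commute:
  assumes "scalar_subspace S" "\<And>j. z * b j = b j * z + sc (c j) * b j" "stable z S"
  shows "stable z (ladder_span b S)"
proof (rule stable_ladder_spanI[OF assms(1)])
  fix i s assume s: "s \<in> S"
  have "z * (b i * s) = b i * (z * s + sc (c i) * s)"
    by (simp add: assms(2) distrib_right distrib_left flip: mult.assoc sc_central[of "b i"])
  then show "z * (b i * s) \<in> ladder_span b S"
    using s assms by (auto intro!: ladder_spanI simp: stable_def scalar_subspace_def)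
qed

lemma stable_ladder_span_shift:
  assumes S: "scalar_subspace S" and "\<And>j. z * b j = b (Suc j) + sc (c j) * b j"
  shows "stable z (ladder_span b S)"
proof (rule stable_ladder_spanI[OF S])
  fix i s assume s: "s \<in> S"
  have "z * (b i * s) = b (Suc i) * s + sc (c i) * (b i * s)"
    by (simp add: assms(2) distrib_right flip: mult.assoc)
  then show "z * (b i * s) \<in> ladder_span b S"
    using ladder_spanI[OF S s, of b] scalar_subspace_ladder_span[OF S, of b] by (simp add: scalar_subspace_def)
qed

lemma stable_ladder_span_ladder:
  assumes S: "scalar_subspace S" and b0: "b 0 = 1"
    and zb: "\<And>j. z * b (Suc j) = b (Suc j) * z + sc (c * of_nat (Suc j)) * (E * b j)"
    and z: "stable z S" and E: "z = E \<or> stable E (ladder_span b S)"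
  shows "stable z (ladder_span b S)"
proof (rule stable_ladder_spanI[OF S])
  fix i s assume s: "s \<in> S"
  note L = ladder_spanI[OF S, of _ b] scalar_subspace_ladder_span[OF S, of b]
  show "z * (b i * s) \<in> ladder_span b S"
  proof (induction i)
    case 0
    then show ?case using L(1)[of _ 0] z s by (simp add: b0 stable_def)
  next
    case (Suc j)
    have "E * (b j * s) \<in> ladder_span b S"
      using E Suc L(1)[OF s] by (auto simp: stable_def)
    moreover have "z * (b (Suc j) * s) = b (Suc j) * (z * s) + sc (c * of_nat (Suc j)) * (E * (b j * s))"
      by (simp only: zb distrib_right flip: mult.assoc)
    ultimately show ?case
      using L z s by (simp add: scalar_subspace_def stable_def)
  qed
qed

lemma sc_numeral: "sc (numeral n) = numeral n"
  using sc_of_nat[of "numeral n"] by simp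

lemma sc_Suc: "sc (c * of_nat (Suc j)) = sc (c * of_nat j) + sc c"
  by (simp add: algebra_simps flip: sc_add)

lemma sc_left_commute: "x * (sc c * y) = sc c * (x * y)"
  by (metis mult.assoc sc_central)

lemma of_nat_left_commute: "x * (of_nat n * y) = of_nat n * (x * (y :: 'a))"
  using sc_left_commute[of x "of_nat n" y] by (simp add: sc_of_nat)

text \<open>
  The powers of \<open>d\<close> form a ladder as soon as \<open>[z, d]\<close> is a multiple of \<open>E\<close> and \<open>d\<close> commutes with \<open>E\<close>; this
  gives the ladders of \<open>E\<close>, \<open>H\<close> and \<open>e\<close>.
\<close>
lemma power_ladder:
  assumes zd: "z * d = d * z + sc c * E" and Ed: "E * d = d * E"
  shows "z * d ^ Suc j = d ^ Suc j * z + sc (c * of_nat (Suc j)) * (E * d ^ j)"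
proof (induction j)
  case 0
  then show ?case by (simp add: zd)
next
  case (Suc j)
  have "z * d ^ Suc (Suc j) = (d * z + sc c * E) * d ^ Suc j"
    by (simp only: power_Suc[of d "Suc j"] zd flip: mult.assoc)
  also have "\<dots> = d * (z * d ^ Suc j) + sc c * (E * d ^ Suc j)"
    by (simp only: distrib_right mult.assoc)
  also have "d * (z * d ^ Suc j) = d ^ Suc (Suc j) * z + sc (c * of_nat (Suc j)) * (d * E * d ^ j)"
    unfolding Suc by (simp only: distrib_left sc_left_commute power_Suc mult.assoc)
  also have "d * E * d ^ j = E * d ^ Suc j"
    by (simp only: Ed[symmetric] mult.assoc power_Suc)
  finally show ?case
    by (simp only: sc_Suc[of c "Suc j"] distrib_right add.assoc)
qed

lemma h_E_power: "h * E ^ Suc j = E ^ Suc j * h + sc (2 * of_nat (Suc j)) * (E * E ^ j)"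
  by (rule power_ladder) (simp_all add: hE sc_numeral)

lemma e_H_power: "e * H ^ Suc j = H ^ Suc j * e + sc (- 2 * of_nat (Suc j)) * (E * H ^ j)"
  by (rule power_ladder) (simp_all add: eH HE sc_minus sc_numeral)

lemma H_e_power: "H * e ^ Suc j = e ^ Suc j * H + sc (2 * of_nat (Suc j)) * (E * e ^ j)"
  by (rule power_ladder) (simp_all add: eH eE sc_numeral)

lemma h_e_power: "h * e ^ j = e ^ j * h + sc (2 * of_nat j) * e ^ j"
proof (induction j)
  case (Suc j)
  have "h * e ^ Suc j = (e * h + sc 2 * e) * e ^ j"
    by (simp add: he sc_numeral flip: mult.assoc)
  also have "\<dots> = e * (h * e ^ j) + sc 2 * e ^ Suc j"
    by (simp only: distrib_right mult.assoc power_Suc)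
  also have "\<dots> = e ^ Suc j * h + sc (2 * of_nat j) * e ^ Suc j + sc 2 * e ^ Suc j"
    unfolding Suc by (simp only: distrib_left sc_left_commute power_Suc mult.assoc)
  finally show ?case
    by (simp only: sc_Suc distrib_right add.assoc)
qed (simp add: sc_0)

text \<open>
  The letter \<open>h\<close> does not commute with \<open>E\<close>: by \<open>E h = (h - 2) E\<close>, commuting with \<open>E\<close> acts on polynomials
  in \<open>h\<close> as a difference operator of step 2. Its analogue of powers are the products
  \<open>h (h - 2) (h - 4) \<dots>\<close>.
\<close>
fun falling :: "nat \<Rightarrow> 'a" where
  "falling 0 = 1"
| "falling (Suc j) = falling j * (h - of_nat (2 * j))"

lemma falling_commute:
  assumes "z * h = h * z"
  shows "z * falling j = falling j * z"
proof (induction j)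
  case (Suc j)
  have "z * (h - of_nat (2 * j)) = (h - of_nat (2 * j)) * z"
    by (simp only: left_diff_distrib right_diff_distrib of_nat_commute[of z] assms)
  then show ?case by (simp only: falling.simps mult.assoc Suc flip: mult.assoc[of z])
qed simp

lemma E_falling: "E * falling (Suc j) = falling (Suc j) * E + sc (- 2 * of_nat (Suc j)) * (E * falling j)"
proof (induction j)
  case 0
  then show ?case by (simp add: hE sc_minus sc_numeral)
next
  case (Suc j)
  define u where "u = h - of_nat (2 * Suc j)"
  define c where "c = sc (- 2 * of_nat (Suc j))"
  have "h - of_nat (2 * j) = u + 2" by (simp add: u_def)
  then have 1: "falling j * u = falling (Suc j) - 2 * falling j"
    by (simp add: distrib_left mult_2 mult_2_right)
  have 2: "E * u = u * E - 2 * E"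
    unfolding u_def right_diff_distrib left_diff_distrib of_nat_commute[of E] hE by simp
  have F: "falling (Suc (Suc j)) = falling (Suc j) * u" by (simp add: u_def)
  have "E * falling (Suc (Suc j)) = E * falling (Suc j) * u"
    by (simp only: F mult.assoc)
  also have "\<dots> = falling (Suc j) * (E * u) + c * (E * (falling j * u))"
    unfolding Suc c_def by (simp only: distrib_right mult.assoc)
  also have "\<dots> = falling (Suc j) * u * E - 2 * (falling (Suc j) * E)
      + (c * (E * falling (Suc j)) - 2 * (c * (E * falling j)))"
    unfolding 1 2 right_diff_distrib mult_2 distrib_left mult.assoc ..
  also have "falling (Suc j) * E = E * falling (Suc j) - c * (E * falling j)"
    unfolding Suc c_def by (simp only: add_diff_cancel_right')
  also have "falling (Suc j) * u * E - 2 * (E * falling (Suc j) - c * (E * falling j))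
      + (c * (E * falling (Suc j)) - 2 * (c * (E * falling j)))
    = falling (Suc j) * u * E + (c * (E * falling (Suc j)) - 2 * (E * falling (Suc j)))"
    unfolding right_diff_distrib by simp
  also have "c * (E * falling (Suc j)) - 2 * (E * falling (Suc j))
      = sc (- 2 * of_nat (Suc (Suc j))) * (E * falling (Suc j))"
    unfolding sc_Suc[of "- 2" "Suc j"] c_def distrib_right by (simp only: sc_minus sc_numeral minus_mult_left diff_conv_add_uminus)
  finally show ?case by (simp only: F)
qed

section \<open>Reduction to polynomials in \<open>E\<close>, \<open>H\<close>, \<open>h\<close>, \<open>e\<close>\<close>

definition E_poly :: "'a set" where "E_poly = ladder_span ((^) E) (range sc)"
definition EH_poly :: "'a set" where "EH_poly = ladder_span ((^) H) E_poly"
definition EHh_poly :: "'a set" where "EHh_poly = ladder_span falling EH_poly"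
definition borel_poly :: "'a set" where "borel_poly = ladder_span ((^) e) EHh_poly"

lemma scalar_subspace_scalars: "scalar_subspace (range sc)"
  unfolding scalar_subspace_def
  by (auto simp flip: sc_add sc_mult intro: range_eqI[of _ _ 0] simp: sc_0)

lemma scalar_subspace_polys:
  "scalar_subspace E_poly" "scalar_subspace EH_poly" "scalar_subspace EHh_poly" "scalar_subspace borel_poly"
  unfolding E_poly_def EH_poly_def EHh_poly_def borel_poly_def
  by (intro scalar_subspace_ladder_span scalar_subspace_scalars)+

lemma power_commute: "z * b = b * z \<Longrightarrow> z * b ^ j = b ^ j * (z :: 'a)"
  by (induction j) (simp_all add: mult.assoc, metis mult.assoc)

lemma e_commutes_E_poly:
  assumes "s \<in> E_poly" shows "e * s = s * e"
  using assms unfolding E_poly_def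
  by (rule ladder_span_commute[rotated 2]) (auto simp: power_commute eE sc_central)

lemma commutes_EH_poly:
  assumes "z * E = E * z" "z * H = H * z" "s \<in> EH_poly"
  shows "z * s = s * z"
proof -
  have "z * s = s * z" if "s \<in> E_poly" for s
    using that unfolding E_poly_def
    by (rule ladder_span_commute[rotated 2]) (auto simp: power_commute assms(1) sc_central)
  with assms(2) show ?thesis
    using ladder_span_commute[of z "(^) H" E_poly s] assms(3)
    by (simp add: EH_poly_def power_commute)
qed

lemma H_commutes_EHh_poly:
  assumes "s \<in> EHh_poly" shows "H * s = s * H"
  using assms unfolding EHh_poly_def
  by (rule ladder_span_commute[rotated 2]) (auto simp: falling_commute hH HE commutes_EH_poly)

text \<open>
  Together these say that \<open>borel_poly\<close> is a left ideal of the subalgebra generated by \<open>e, h, E, H\<close>; as it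
  contains \<open>1\<close>, it is that subalgebra.
\<close>
lemma stable_polys: "stable E E_poly" "stable E EH_poly" "stable H EH_poly"
  "stable E EHh_poly" "stable H EHh_poly" "stable h EHh_poly"
  "stable E borel_poly" "stable H borel_poly" "stable h borel_poly" "stable e borel_poly"
proof -
  show 1: "stable E E_poly" unfolding E_poly_def
    by (rule stable_ladder_span_shift[where c = "\<lambda>_. 0", OF scalar_subspace_scalars]) (simp add: sc_0)
  show 2: "stable E EH_poly" unfolding EH_poly_def
    by (rule stable_ladder_span_commute[where c = "\<lambda>_. 0", OF scalar_subspace_polys(1) _ 1])
      (simp add: sc_0 power_commute HE)
  show 3: "stable H EH_poly" unfolding EH_poly_def
    by (rule stable_ladder_span_shift[where c = "\<lambda>_. 0", OF scalar_subspace_polys(1)]) (simp add: sc_0)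
  show 4: "stable E EHh_poly" unfolding EHh_poly_def
    by (rule stable_ladder_span_ladder[OF scalar_subspace_polys(2) _ E_falling 2]) simp_all
  show 5: "stable H EHh_poly" unfolding EHh_poly_def
    by (rule stable_ladder_span_commute[where c = "\<lambda>_. 0", OF scalar_subspace_polys(2) _ 3])
      (simp add: sc_0 falling_commute hH)
  show 6: "stable h EHh_poly" unfolding EHh_poly_def
    by (rule stable_ladder_span_shift[where c = "\<lambda>j. of_nat (2 * j)", OF scalar_subspace_polys(2)])
      (simp add: falling_commute[of h] right_diff_distrib of_nat_commute sc_of_nat del: of_nat_mult)
  show 7: "stable E borel_poly" unfolding borel_poly_def
    by (rule stable_ladder_span_commute[where c = "\<lambda>_. 0", OF scalar_subspace_polys(3) _ 4])
      (simp add: sc_0 power_commute eE)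
  show "stable H borel_poly" unfolding borel_poly_def
    by (rule stable_ladder_span_ladder[OF scalar_subspace_polys(3) _ H_e_power 5])
      (simp_all add: 7[unfolded borel_poly_def])
  show "stable h borel_poly" unfolding borel_poly_def
    by (rule stable_ladder_span_commute[OF scalar_subspace_polys(3) h_e_power 6])
  show "stable e borel_poly" unfolding borel_poly_def
    by (rule stable_ladder_span_shift[where c = "\<lambda>_. 0", OF scalar_subspace_polys(3)]) (simp add: sc_0)
qed

lemma one_in_borel_poly: "1 \<in> borel_poly"
proof -
  have "1 \<in> range sc" using sc_1 by (metis rangeI)
  then have "1 \<in> E_poly" unfolding E_poly_def
    using ladder_spanI[OF scalar_subspace_scalars, of 1 "(^) E" 0] by simp
  then have "1 \<in> EH_poly" unfolding EH_poly_def
    using ladder_spanI[OF scalar_subspace_polys(1), of 1 "(^) H" 0] by simp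
  then have "1 \<in> EHh_poly" unfolding EHh_poly_def
    using ladder_spanI[OF scalar_subspace_polys(2), of 1 "falling" 0] by simp
  then show ?thesis unfolding borel_poly_def
    using ladder_spanI[OF scalar_subspace_polys(3), of 1 "(^) e" 0] by simp
qed

text \<open>
  Four ladders strip off the letters \<open>e\<close>, \<open>h\<close>, \<open>H\<close>, \<open>E\<close> in this order, by commutators with \<open>H\<close>, \<open>E\<close>, \<open>e\<close>,
  \<open>h\<close>: each of these commutes with the letters that are still left. In the end only scalars remain, and
  a nonzero scalar in \<open>I\<close> would be a unit.
\<close>
lemma borel_poly_inter_ideal:
  assumes I: "two_sided_ideal I" and sat: "\<And>x. E * x \<in> I \<Longrightarrow> x \<in> I" and K: "left_ideal K"
    and proper: "1 \<notin> I"
  shows "borel_poly \<inter> I \<subseteq> K"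
proof -
  have "x \<in> K" if "x \<in> range sc \<inter> I" for x
  proof -
    from that obtain c where x: "x = sc c" "x \<in> I" by auto
    have "c = 0"
      using left_ideal_sc_cancel[OF two_sided_ideal_imp_left[OF I], of c 1] x proper by auto
    then show ?thesis using x left_ideal_0[OF K] by (simp add: sc_0)
  qed
  then have 0: "range sc \<inter> I \<subseteq> K" by blast
  have 1: "E_poly \<inter> I \<subseteq> K" unfolding E_poly_def
    by (rule ladder_span_ideal[OF I sat K scalar_subspace_scalars 0 _ _ h_E_power]) (auto simp: sc_central)
  have 2: "EH_poly \<inter> I \<subseteq> K" unfolding EH_poly_def
    by (rule ladder_span_ideal[OF I sat K scalar_subspace_polys(1) 1 _ _ e_H_power]) (auto simp: e_commutes_E_poly)
  have 3: "EHh_poly \<inter> I \<subseteq> K" unfolding EHh_poly_def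
    by (rule ladder_span_ideal[OF I sat K scalar_subspace_polys(2) 2 _ _ E_falling]) (auto simp: commutes_EH_poly HE)
  show ?thesis unfolding borel_poly_def
    by (rule ladder_span_ideal[OF I sat K scalar_subspace_polys(3) 3 _ _ H_e_power]) (auto simp: H_commutes_EHh_poly)
qed

lemma E_power_h: "E ^ n * h = (h - of_nat (2 * n)) * E ^ n"
proof (induction n)
  case (Suc n)
  have "E ^ Suc n * h = E * (h - of_nat (2 * n)) * E ^ n"
    by (simp only: power_Suc mult.assoc Suc)
  also have "E * (h - of_nat (2 * n)) = (h - of_nat (2 * Suc n)) * E"
  proof -
    have "of_nat (2 * Suc n) * E = 2 * E + of_nat (2 * n) * E"
      by (simp add: distrib_right mult_2)
    then show ?thesis
      by (simp only: right_diff_distrib left_diff_distrib of_nat_commute[of E] hE) simp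
  qed
  finally show ?case by (simp only: power_Suc mult.assoc)
qed simp

text \<open>
  The elements \<open>e\<close>, \<open>h\<close>, \<open>E\<close>, \<open>H\<close> normalise the powers of \<open>E\<close> and preserve \<open>T\<close>. The other two are solved
  for from the central elements: \<open>4 E G = C' - H\<^sup>2\<close>, and \<open>2 E f = C - H h - 2 G e\<close>, where one more \<open>E\<close>
  is spent on \<open>G\<close>.
\<close>
lemma E_power_mult_generator:
  assumes T: "scalar_subspace T" and st: "stable E T" "stable H T" "stable h T" "stable e T"
    and cas: "\<And>y. (cas - sc theta) * y \<in> T" and cas_bar: "\<And>y. (cas_bar - sc chi) * y \<in> T"
    and x: "E ^ n * x \<in> T" and g: "g \<in> {e, h, f, E, H, G}"
  shows "\<exists>m. E ^ m * (g * x) \<in> T"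
proof -
  define y where "y = E ^ n * x"
  have y: "y \<in> T" using x by (simp add: y_def)
  have add: "u + v \<in> T" if "u \<in> T" "v \<in> T" for u v using that T by (simp add: scalar_subspace_def)
  have sc: "sc c * u \<in> T" if "u \<in> T" for u c using that T by (simp add: scalar_subspace_def)
  have uminus: "- u \<in> T" if "u \<in> T" for u using sc[OF that, of "- 1"] by (simp add: sc_minus sc_1)
  have diff: "u - v \<in> T" if "u \<in> T" "v \<in> T" for u v using add[OF that(1) uminus[OF that(2)]] by simp
  have of_nat: "of_nat k * u \<in> T" if "u \<in> T" for u k using sc[OF that, of "of_nat k"] by (simp add: sc_of_nat)
  have E: "E * u \<in> T" and H: "H * u \<in> T" and h: "h * u \<in> T" and e: "e * u \<in> T" if "u \<in> T" for u
    using st that by (auto simp: stable_def)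
  have G: "E * (G * u) \<in> T" if "u \<in> T" for u
  proof -
    have "sc (1 / 4) * (((cas_bar - sc chi) * u + sc chi * u) - H * (H * u)) \<in> T"
      using that by (intro sc diff add cas_bar H)
    also have "((cas_bar - sc chi) * u + sc chi * u) - H * (H * u) = sc 4 * (E * (G * u))"
      by (simp add: cas_bar_def algebra_simps power2_eq_square GE sc_numeral)
    also have "sc (1 / 4) * (sc 4 * (E * (G * u))) = E * (G * u)"
      by (simp add: sc_1 flip: mult.assoc sc_mult)
    finally show ?thesis .
  qed
  have f: "E * (E * (f * u)) \<in> T" if "u \<in> T" for u
  proof -
    have "sc (1 / 2) * (E * (((cas - sc theta) * u + sc theta * u) - H * (h * u)) - of_nat 2 * (E * (G * (e * u)))) \<in> T"
      using that by (intro sc diff add cas H E h of_nat G e)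
    also have "E * (((cas - sc theta) * u + sc theta * u) - H * (h * u)) - of_nat 2 * (E * (G * (e * u)))
        = sc 2 * (E * (E * (f * u)))"
      by (simp add: cas_def algebra_simps sc_numeral mult_2)
    also have "sc (1 / 2) * (sc 2 * (E * (E * (f * u)))) = E * (E * (f * u))"
      by (simp add: sc_1 flip: mult.assoc sc_mult)
    finally show ?thesis .
  qed
  have comm: "E ^ n * (z * x) = z * y" if "z * E = E * z" for z
    using power_commute[OF that, of n] by (simp add: y_def flip: mult.assoc)
  consider "g = e" | "g = h" | "g = f" | "g = E" | "g = H" | "g = G" using g by blast
  then show ?thesis
  proof cases
    case 1
    then show ?thesis using comm[OF eE] e[OF y] by (intro exI[of _ n]) simp
  next
    case 2
    have "E ^ n * (h * x) = h * y - of_nat (2 * n) * y"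
      by (simp only: y_def left_diff_distrib E_power_h flip: mult.assoc)
    also have "\<dots> \<in> T" by (intro diff of_nat h y)
    finally show ?thesis using 2 by blast
  next
    case 3
    show ?thesis
    proof (cases n)
      case 0
      then have "E ^ 2 * (f * x) \<in> T"
        using f[OF y] by (simp add: y_def power2_eq_square mult.assoc)
      then show ?thesis using 3 by blast
    next
      case (Suc p)
      have "E ^ (n + 2) * (f * x) = E * (E * (E ^ n * f * x))"
        by (simp add: power_add power2_eq_square power_commutes mult.assoc)
      also have "\<dots> = E * (E * (f * y)) + of_nat n * (E * (E * (H * (E ^ p * x))))"
        unfolding Suc E_power_f y_def by (simp only: distrib_left distrib_right mult.assoc of_nat_left_commute)
      also have "E * (E * (H * (E ^ p * x))) = E * (H * y)"
        by (simp only: y_def Suc power_Suc mult.assoc) (simp only: HE[symmetric] flip: mult.assoc)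
      also have "E * (E * (f * y)) + of_nat n * (E * (H * y)) \<in> T"
        by (intro add f of_nat E H y)
      finally show ?thesis using 3 by blast
    qed
  next
    case 4
    then show ?thesis using comm[OF refl] E[OF y] by (intro exI[of _ n]) simp
  next
    case 5
    then show ?thesis using comm[OF HE] H[OF y] by (intro exI[of _ n]) simp
  next
    case 6
    have "E ^ Suc n * (G * x) \<in> T"
      using G[OF y] comm[OF GE] by (simp add: mult.assoc)
    then show ?thesis using 6 by blast
  qed
qed

end

text \<open>
  Generation by the six elements is stated as an induction principle for left multiplication.
\<close>
locale takiff_algebra = takiff_generators sc e h f E H G
  for sc :: "complex \<Rightarrow> 'a::ring_1" and e h f E H G +
  assumes generated: "P 1 \<Longrightarrow> (\<And>x y. P x \<Longrightarrow> P y \<Longrightarrow> P (x + y)) \<Longrightarrow> (\<And>c x. P x \<Longrightarrow> P (sc c * x))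
    \<Longrightarrow> (\<And>g x. g \<in> {e, h, f, E, H, G} \<Longrightarrow> P x \<Longrightarrow> P (g * x)) \<Longrightarrow> P (x :: 'a)"
begin

lemma ad_f_nilpotent: "\<exists>n. (ad_f ^^ n) x = 0"
proof (rule generated[where P = "\<lambda>x. \<exists>n. (ad_f ^^ n) x = 0"])
  have "(ad_f ^^ 1) 1 = 0" by (simp add: ad_f_def)
  then show "\<exists>n. (ad_f ^^ n) 1 = 0" by blast
next
  fix c x assume "\<exists>n. (ad_f ^^ n) x = 0"
  moreover have "(ad_f ^^ 1) (sc c) = 0" by (simp add: ad_f_def sc_central)
  ultimately show "\<exists>n. (ad_f ^^ n) (sc c * x) = 0"
    using ad_f_nilpotent_mult by blast
qed (rule ad_f_nilpotent_add ad_f_nilpotent_mult[OF ad_f_nilpotent_generators]; assumption)+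

text \<open>
  The set of all \<open>x\<close> with this property is a subspace that contains \<open>1\<close> and, by
  \<open>E_power_mult_generator\<close> for the sum \<open>T\<close> of \<open>borel_poly\<close> and \<open>K\<close>, is stable under left multiplication
  by the generators.
\<close>
lemma normal_form:
  assumes K: "two_sided_ideal K" "cas - sc theta \<in> K" "cas_bar - sc chi \<in> K"
  shows "\<exists>n. \<exists>b\<in>borel_poly. E ^ n * x - b \<in> K"
proof -
  define T where "T = {b + k | b k. b \<in> borel_poly \<and> k \<in> K}"
  note L = two_sided_ideal_imp_left[OF K(1)]
  note B = scalar_subspace_polys(4)
  have TI: "b + k \<in> T" if "b \<in> borel_poly" "k \<in> K" for b k
    using that by (auto simp: T_def)
  have K_T: "k \<in> T" if "k \<in> K" for k
    using TI[of 0 k] that B by (simp add: scalar_subspace_def)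
  have "u + v \<in> T" if "u \<in> T" "v \<in> T" for u v
  proof -
    obtain b k b' k' where "u = b + k" "v = b' + k'" "b \<in> borel_poly" "k \<in> K" "b' \<in> borel_poly" "k' \<in> K"
      using \<open>u \<in> T\<close> \<open>v \<in> T\<close> unfolding T_def by blast
    moreover have "(b + k) + (b' + k') = (b + b') + (k + k')" by simp
    ultimately show ?thesis
      using TI[of "b + b'" "k + k'"] B left_ideal_add[OF L] by (simp only: scalar_subspace_def)
  qed
  moreover have T_mult: "z * u \<in> T" if "u \<in> T" "\<And>b. b \<in> borel_poly \<Longrightarrow> z * b \<in> borel_poly" for u z
    using that left_ideal_mult[OF L] TI unfolding T_def by (auto simp: distrib_left)
  ultimately have T: "scalar_subspace T"
    using K_T[OF left_ideal_0[OF L]] B by (auto simp: scalar_subspace_def)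
  have st: "stable E T" "stable H T" "stable h T" "stable e T"
    using T_mult stable_polys unfolding stable_def by blast+
  have "\<exists>n. E ^ n * x \<in> T"
  proof (rule generated[where P = "\<lambda>x. \<exists>n. E ^ n * x \<in> T"])
    have "E ^ 0 * 1 \<in> T"
      using TI[OF one_in_borel_poly left_ideal_0[OF L]] by simp
    then show "\<exists>n. E ^ n * 1 \<in> T" by blast
  next
    fix x y assume "\<exists>n. E ^ n * x \<in> T" "\<exists>n. E ^ n * y \<in> T"
    then obtain n m where nm: "E ^ n * x \<in> T" "E ^ m * y \<in> T" by blast
    have E_pow: "E ^ k * u \<in> T" if "u \<in> T" for k u
      using that st(1) by (induction k) (simp_all add: stable_def mult.assoc)
    \<comment> \<open>Two exponents can be raised to a common one, since \<open>T\<close> is stable under \<open>E\<close>.\<close>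
    have "E ^ (n + m) * (x + y) = E ^ m * (E ^ n * x) + E ^ n * (E ^ m * y)"
      by (simp add: distrib_left add.commute[of n] flip: mult.assoc power_add)
    then have "E ^ (n + m) * (x + y) \<in> T"
      using E_pow[OF nm(1)] E_pow[OF nm(2)] T by (simp add: scalar_subspace_def)
    then show "\<exists>n. E ^ n * (x + y) \<in> T" by blast
  next
    fix c x assume "\<exists>n. E ^ n * x \<in> T"
    then obtain n where "E ^ n * x \<in> T" by blast
    then have "E ^ n * (sc c * x) \<in> T"
      using T by (simp add: sc_left_commute scalar_subspace_def)
    then show "\<exists>n. E ^ n * (sc c * x) \<in> T" by blast
  next
    fix g x assume "g \<in> {e, h, f, E, H, G}" "\<exists>n. E ^ n * x \<in> T"
    moreover have "(cas - sc theta) * y \<in> T" "(cas_bar - sc chi) * y \<in> T" for y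
      by (intro K_T two_sided_ideal_mult_right[OF K(1)] K(2,3))+
    ultimately show "\<exists>n. E ^ n * (g * x) \<in> T"
      by (elim exE) (rule E_power_mult_generator[OF T st])
  qed
  then obtain n b k where "E ^ n * x = b + k" "b \<in> borel_poly" "k \<in> K"
    unfolding T_def by auto
  then have "E ^ n * x - b \<in> K" by simp
  with \<open>b \<in> borel_poly\<close> show ?thesis by blast
qed

text \<open>
  The normal form of \<open>E\<^sup>n x\<close> lies in \<open>I\<close> and is therefore trivial; so \<open>E\<^sup>n x\<close> is in \<open>K\<close>, and torsion-freeness
  is used a second time, now for \<open>K\<close>.
\<close>
theorem proper_ideal_subset:
  assumes nz: "theta \<noteq> 0 \<or> chi \<noteq> 0"
    and K: "two_sided_ideal K" "cas - sc theta \<in> K" "cas_bar - sc chi \<in> K"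
    and I: "two_sided_ideal I" "K \<subseteq> I" "1 \<notin> I"
  shows "I \<subseteq> K"
proof
  fix x assume x: "x \<in> I"
  note L = two_sided_ideal_imp_left
  have I_cas: "cas - sc theta \<in> I" "cas_bar - sc chi \<in> I" using K I by auto
  have sat: "y \<in> I" if "E * y \<in> I" for y
    using E_torsion_free[OF I(1) I_cas nz ad_f_nilpotent, of 1 y] that by simp
  obtain n b where b: "b \<in> borel_poly" "E ^ n * x - b \<in> K"
    using normal_form[OF K] by blast
  have "b = E ^ n * x - (E ^ n * x - b)" by simp
  also have "\<dots> \<in> I"
    by (rule left_ideal_diff[OF L[OF I(1)] left_ideal_mult[OF L[OF I(1)] x]]) (use b I(2) in auto)
  finally have "b \<in> K"
    using borel_poly_inter_ideal[OF I(1) sat L[OF K(1)] I(3)] b(1) by blast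
  then have "E ^ n * x \<in> K"
    using left_ideal_add[OF L[OF K(1)] b(2), of b] by simp
  then show "x \<in> K"
    using E_torsion_free[OF K nz ad_f_nilpotent] by blast
qed

end

section \<open>The free algebra\<close>

lemma free_algebra_eq_sum:
  fixes p :: "'a free_algebra"
  shows "p = (\<Sum>w\<in>Poly_Mapping.keys p. Poly_Mapping.single w (Poly_Mapping.lookup p w))"
  by (rule poly_mapping_eqI) (simp add: lookup_sum lookup_single when_def in_keys_iff)

lemma single_Cons:
  "Poly_Mapping.single (Word (u # us)) c = gen u * Poly_Mapping.single (Word us) c"
  by (simp add: gen_def mult_single plus_word_def)

lemma free_algebra_induct [case_names one add scalar gen]:
  fixes p :: "'a free_algebra"
  assumes one: "P 1" and add: "\<And>p q. P p \<Longrightarrow> P q \<Longrightarrow> P (p + q)"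
    and scalar: "\<And>c p. P p \<Longrightarrow> P (scalar c * p)" and gen: "\<And>u p. P p \<Longrightarrow> P (gen u * p)"
  shows "P p"
proof -
  have "P (scalar 0 * 1)" by (intro scalar one)
  then have zero: "P 0" by (simp add: scalar_def)
  have single: "P (Poly_Mapping.single (Word us) c)" for us c
  proof (induction us)
    case Nil
    have "P (scalar c * 1)" by (intro scalar one)
    then show ?case by (simp add: scalar_def zero_word_def)
  next
    case (Cons u us)
    then show ?case by (simp add: single_Cons gen)
  qed
  have "P (\<Sum>w\<in>A. Poly_Mapping.single w (c w))" if "finite A" for A :: "'a word set" and c
    using that
  proof induction
    case (insert w A)
    then show ?case using single[of "letters w" "c w"] by (simp add: add)
  qed (simp add: zero)
  then show ?thesis
    by (subst free_algebra_eq_sum) simp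
qed

lemma scalar_central: "p * scalar c = scalar c * p"
proof (induction p rule: free_algebra_induct)
  case (gen u p)
  have "gen u * scalar c = scalar c * gen u"
    by (simp add: gen_def scalar_def mult_single)
  with gen show ?case by (metis mult.assoc)
next
  case (scalar d p)
  have "scalar d * scalar c = scalar c * scalar d"
    by (simp add: scalar_def mult_single mult.commute)
  with scalar show ?case by (metis mult.assoc)
qed (simp_all add: algebra_simps)

lemma scalar_1: "scalar 1 = 1" and scalar_add: "scalar (a + b) = scalar a + scalar b"
  and scalar_mult: "scalar (a * b) = scalar a * scalar b"
  by (simp_all add: scalar_def single_add mult_single)

section \<open>A representation by differential operators\<close>

text \<open>
  A family \<open>v\<close> is the formal series \<open>\<Sum>i j. v i j x\<^sup>i y\<^sup>j\<close>. No finiteness is imposed, because all operators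
  below are finite combinations of index shifts; and negative exponents of \<open>y\<close> are allowed so that
  the shifts have no boundary cases.
\<close>
type_synonym laurent = "int \<Rightarrow> int \<Rightarrow> complex"

text \<open>
  The coefficients of the following differential operators. On the coordinate ring of the quadric
  \<open>y\<^sup>2 + 4 x z = \<chi>\<close>, localised at \<open>x\<close>, the elements \<open>E, H, G\<close> are the multiplications by \<open>x\<close>, \<open>y\<close> and
  \<open>z = (\<chi> - y\<^sup>2) / (4 x)\<close>. The adjoint action makes \<open>e\<close> and \<open>h\<close> the vector fields \<open>- 2 x \<partial>\<^sub>y\<close> and \<open>2 x \<partial>\<^sub>x\<close>.
  Solving \<open>C = \<theta>\<close> for \<open>f\<close> then gives \<open>f = \<theta> / (2 x) - y \<partial>\<^sub>x + (\<chi> - y\<^sup>2) / (2 x) \<partial>\<^sub>y\<close>.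
\<close>
definition takiff_op :: "complex \<Rightarrow> complex \<Rightarrow> takiff \<Rightarrow> laurent \<Rightarrow> laurent" where
  "takiff_op theta chi u v = (\<lambda>i j.
     fst u $ 1 * (- 2 * of_int (j + 1) * v (i - 1) (j + 1)) +
     fst u $ 2 * (2 * of_int i * v i j) +
     fst u $ 3 * (theta / 2 * v (i + 1) j - of_int (i + 1) * v (i + 1) (j - 1)
       + (chi * of_int (j + 1) * v (i + 1) (j + 1) - of_int (j - 1) * v (i + 1) (j - 1)) / 2) +
     snd u $ 1 * v (i - 1) j +
     snd u $ 2 * v i (j - 1) +
     snd u $ 3 * ((chi * v (i + 1) j - v (i + 1) (j - 2)) / 4))"

lemma takiff_op_scale: "takiff_op theta chi (takiff_scale c u) v i j = c * takiff_op theta chi u v i j"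
  by (simp add: takiff_op_def takiff_scale_def algebra_simps)

lemma takiff_op_add: "takiff_op theta chi (u + w) v i j = takiff_op theta chi u v i j + takiff_op theta chi w v i j"
  by (simp add: takiff_op_def add_divide_distrib diff_divide_distrib algebra_simps)

lemma takiff_op_add_right:
  "takiff_op theta chi u (\<lambda>i j. v i j + w i j) i j = takiff_op theta chi u v i j + takiff_op theta chi u w i j"
  by (simp add: takiff_op_def add_divide_distrib diff_divide_distrib algebra_simps)

lemma takiff_op_scale_right:
  "takiff_op theta chi u (\<lambda>i j. c * v i j) i j = c * takiff_op theta chi u v i j"
  by (simp add: takiff_op_def algebra_simps)

lemma takiff_op_zero_right: "takiff_op theta chi u (\<lambda>_ _. 0) i j = 0"
  by (simp add: takiff_op_def)

lemma takiff_op_sum: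
  "takiff_op theta chi u (\<lambda>i j. \<Sum>a\<in>A. c a * g a i j) i j = (\<Sum>a\<in>A. c a * takiff_op theta chi u (g a) i j)"
  by (induction A rule: infinite_finite_induct)
    (simp_all add: takiff_op_add_right takiff_op_scale_right takiff_op_zero_right)

definition takiff_basis :: "takiff set" where
  "takiff_basis = {takiff_tensor x p | x p. x \<in> {sl2_e, sl2_h, sl2_f} \<and> p \<in> {1, [:0, 1:]}}"

lemma sl2_decomposition: "x = x $ 1 *s sl2_e + x $ 2 *s sl2_h + x $ 3 *s sl2_f"
  by (simp add: sl2_e_def sl2_h_def sl2_f_def vec_eq_iff forall_3)

lemma takiff_scale_tensor: "takiff_tensor (c *s x) p = takiff_scale c (takiff_tensor x p)"
  by (simp add: takiff_tensor_def takiff_scale_def vec_eq_iff)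

lemma takiff_tensor_minus: "takiff_tensor (- x) p = takiff_scale (- 1) (takiff_tensor x p)"
  by (simp add: takiff_tensor_def takiff_scale_def vec_eq_iff)

lemma takiff_tensor_add: "takiff_tensor (x + y) p = takiff_tensor x p + takiff_tensor y p"
  by (simp add: takiff_tensor_def vec_eq_iff algebra_simps)

lemma takiff_induct:
  assumes add: "\<And>u w. P u \<Longrightarrow> P w \<Longrightarrow> P (u + w)" and scale: "\<And>c u. P u \<Longrightarrow> P (takiff_scale c u)"
    and basis: "\<And>u. u \<in> takiff_basis \<Longrightarrow> P u"
  shows "P u"
proof -
  have "P (takiff_tensor x p)" if "p \<in> {1, [:0, 1:]}" for x p
    by (subst sl2_decomposition[of x], unfold takiff_tensor_add takiff_scale_tensor, intro add scale basis)
      (use that in \<open>auto simp: takiff_basis_def\<close>)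
  then show ?thesis
    by (subst takiff_tensor_decomposition) (simp add: add)
qed

lemma takiff_op_basis:
  "takiff_op theta chi (takiff_tensor sl2_e 1) v i j = - 2 * of_int (j + 1) * v (i - 1) (j + 1)"
  "takiff_op theta chi (takiff_tensor sl2_h 1) v i j = 2 * of_int i * v i j"
  "takiff_op theta chi (takiff_tensor sl2_f 1) v i j =
     theta / 2 * v (i + 1) j - of_int (i + 1) * v (i + 1) (j - 1)
       + (chi * of_int (j + 1) * v (i + 1) (j + 1) - of_int (j - 1) * v (i + 1) (j - 1)) / 2"
  "takiff_op theta chi (takiff_tensor sl2_e [:0, 1:]) v i j = v (i - 1) j"
  "takiff_op theta chi (takiff_tensor sl2_h [:0, 1:]) v i j = v i (j - 1)"
  "takiff_op theta chi (takiff_tensor sl2_f [:0, 1:]) v i j = (chi * v (i + 1) j - v (i + 1) (j - 2)) / 4"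
  by (simp_all add: takiff_op_def takiff_tensor_def sl2_e_def sl2_h_def sl2_f_def)

text \<open>
  A direct check on the 36 pairs; bilinearity extends it to the whole Lie algebra in
  \<open>takiff_op_bracket\<close>.
\<close>
lemma takiff_op_bracket_basis:
  assumes "u \<in> takiff_basis" "w \<in> takiff_basis"
  shows "takiff_op theta chi (takiff_bracket u w) v i j
     = takiff_op theta chi u (takiff_op theta chi w v) i j - takiff_op theta chi w (takiff_op theta chi u v) i j"
proof -
  have zero: "takiff_op theta chi 0 v i j = 0"
    by (simp add: takiff_op_def)
  have br: "sl2_bracket sl2_e sl2_h = (- 2) *s sl2_e" "sl2_bracket sl2_f sl2_h = 2 *s sl2_f"
    "sl2_bracket sl2_f sl2_e = (- 1) *s sl2_h"
    "sl2_bracket sl2_e sl2_e = 0" "sl2_bracket sl2_f sl2_f = 0" "sl2_bracket sl2_h sl2_h = 0"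
    by (simp_all add: sl2_bracket_def sl2_e_def sl2_h_def sl2_f_def vec_eq_iff forall_3)
  have tz: "takiff_tensor 0 p = 0" "takiff_tensor x [:0, 0, 1:] = 0" for p x
    by (simp_all add: takiff_tensor_def zero_prod_def)
  show ?thesis
    using assms unfolding takiff_basis_def
    by (auto simp: takiff_bracket_tensor sl2_bracket_basis br takiff_scale_tensor takiff_tensor_minus takiff_op_scale zero tz takiff_op_basis)
     (simp_all add: add_divide_distrib diff_divide_distrib algebra_simps)
qed

lemma takiff_bracket_bilinear:
  "takiff_bracket (u + u') w = takiff_bracket u w + takiff_bracket u' w"
  "takiff_bracket u (w + w') = takiff_bracket u w + takiff_bracket u w'"
  "takiff_bracket (takiff_scale c u) w = takiff_scale c (takiff_bracket u w)"
  "takiff_bracket u (takiff_scale c w) = takiff_scale c (takiff_bracket u w)"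
proof -
  interpret complex_lie_algebra takiff_scale takiff_bracket by (rule complex_lie_algebra_takiff)
  show "takiff_bracket (u + u') w = takiff_bracket u w + takiff_bracket u' w"
    "takiff_bracket u (w + w') = takiff_bracket u w + takiff_bracket u w'"
    "takiff_bracket (takiff_scale c u) w = takiff_scale c (takiff_bracket u w)"
    "takiff_bracket u (takiff_scale c w) = takiff_scale c (takiff_bracket u w)"
    by (rule bracket_add_left bracket_add_right bracket_scale_left bracket_scale_right)+
qed

lemma takiff_op_bracket:
  "takiff_op theta chi (takiff_bracket u w) v i j
     = takiff_op theta chi u (takiff_op theta chi w v) i j - takiff_op theta chi w (takiff_op theta chi u v) i j"
proof -
  have add: "takiff_op theta chi (x + y) v = (\<lambda>i j. takiff_op theta chi x v i j + takiff_op theta chi y v i j)"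
    and scale: "takiff_op theta chi (takiff_scale c x) v = (\<lambda>i j. c * takiff_op theta chi x v i j)" for c x y v
    by (simp_all add: fun_eq_iff takiff_op_add takiff_op_scale)
  note lin = takiff_bracket_bilinear takiff_op_add takiff_op_scale add scale takiff_op_add_right takiff_op_scale_right
  have 1: "takiff_op theta chi (takiff_bracket u w) v i j
     = takiff_op theta chi u (takiff_op theta chi w v) i j - takiff_op theta chi w (takiff_op theta chi u v) i j"
    if w: "w \<in> takiff_basis" for u w
    by (induction u rule: takiff_induct)
      (use w in \<open>simp_all add: lin takiff_op_bracket_basis right_diff_distrib\<close>)
  show ?thesis
    by (induction w rule: takiff_induct) (simp_all add: lin 1 right_diff_distrib)
qed

definition word_op :: "complex \<Rightarrow> complex \<Rightarrow> takiff word \<Rightarrow> laurent \<Rightarrow> laurent" where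
  "word_op theta chi w = foldr (takiff_op theta chi) (letters w)"

lemma word_op_simps:
  "word_op theta chi 0 v = v" "word_op theta chi (Word [u]) = takiff_op theta chi u"
  "word_op theta chi (w + w') v = word_op theta chi w (word_op theta chi w' v)"
  by (auto simp: word_op_def zero_word_def plus_word_def)

lemma word_op_sum:
  "word_op theta chi w (\<lambda>i j. \<Sum>a\<in>A. c a * g a i j) i j = (\<Sum>a\<in>A. c a * word_op theta chi w (g a) i j)"
proof -
  have "foldr (takiff_op theta chi) us (\<lambda>i j. \<Sum>a\<in>A. c a * g a i j) i j
      = (\<Sum>a\<in>A. c a * foldr (takiff_op theta chi) us (g a) i j)" for us i j
  proof (induction us arbitrary: i j)
    case (Cons u us)
    then have "foldr (takiff_op theta chi) us (\<lambda>i j. \<Sum>a\<in>A. c a * g a i j)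
      = (\<lambda>i j. \<Sum>a\<in>A. c a * foldr (takiff_op theta chi) us (g a) i j)"
      by blast
    then show ?case by (simp add: takiff_op_sum)
  qed simp
  then show ?thesis by (simp add: word_op_def)
qed

definition alg_op :: "complex \<Rightarrow> complex \<Rightarrow> takiff free_algebra \<Rightarrow> laurent \<Rightarrow> laurent" where
  "alg_op theta chi p v = (\<lambda>i j. \<Sum>w\<in>Poly_Mapping.keys p. Poly_Mapping.lookup p w * word_op theta chi w v i j)"

lemma alg_op_superset:
  assumes "finite A" "Poly_Mapping.keys p \<subseteq> A"
  shows "alg_op theta chi p v i j = (\<Sum>w\<in>A. Poly_Mapping.lookup p w * word_op theta chi w v i j)"
  unfolding alg_op_def using assms by (intro sum.mono_neutral_left) (auto simp: in_keys_iff)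

lemma alg_op_add: "alg_op theta chi (p + q) v i j = alg_op theta chi p v i j + alg_op theta chi q v i j"
proof -
  let ?A = "Poly_Mapping.keys p \<union> Poly_Mapping.keys q"
  have "Poly_Mapping.keys (p + q) \<subseteq> ?A" by (rule Poly_Mapping.keys_add)
  then show ?thesis
    by (simp add: alg_op_superset[of ?A] lookup_add distrib_right sum.distrib)
qed

lemma alg_op_zero: "alg_op theta chi 0 v i j = 0"
  by (simp add: alg_op_def)

lemma alg_op_sum: "alg_op theta chi (\<Sum>a\<in>A. g a) v i j = (\<Sum>a\<in>A. alg_op theta chi (g a) v i j)"
  by (induction A rule: infinite_finite_induct) (simp_all add: alg_op_add alg_op_zero)

lemma alg_op_uminus: "alg_op theta chi (- p) v i j = - alg_op theta chi p v i j"
  using alg_op_add[of theta chi p "- p" v i j] by (simp add: alg_op_zero eq_neg_iff_add_eq_0 add.commute)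

lemma alg_op_diff: "alg_op theta chi (p - q) v i j = alg_op theta chi p v i j - alg_op theta chi q v i j"
  using alg_op_add[of theta chi p "- q" v i j] by (simp add: alg_op_uminus)

lemma alg_op_single: "alg_op theta chi (Poly_Mapping.single w c) v i j = c * word_op theta chi w v i j"
  by (simp add: alg_op_def)

lemma alg_op_mult: "alg_op theta chi (p * q) v i j = alg_op theta chi p (alg_op theta chi q v) i j"
proof -
  let ?l = Poly_Mapping.lookup and ?k = Poly_Mapping.keys
  have "p * q = (\<Sum>w\<in>?k p. \<Sum>w'\<in>?k q. Poly_Mapping.single (w + w') (?l p w * ?l q w'))"
    by (subst free_algebra_eq_sum[of p], subst free_algebra_eq_sum[of q])
      (simp add: sum_product mult_single)
  then have "alg_op theta chi (p * q) v i j
      = (\<Sum>w\<in>?k p. ?l p w * (\<Sum>w'\<in>?k q. ?l q w' * word_op theta chi w (word_op theta chi w' v) i j))"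
    by (simp add: alg_op_sum alg_op_single word_op_simps sum_distrib_left mult.assoc)
  also have "\<dots> = alg_op theta chi p (alg_op theta chi q v) i j"
    unfolding alg_op_def[of theta chi q] unfolding alg_op_def word_op_sum ..
  finally show ?thesis .
qed

lemma alg_op_gen: "alg_op theta chi (gen u) v i j = takiff_op theta chi u v i j"
  and alg_op_scalar: "alg_op theta chi (scalar c) v i j = c * v i j"
  and alg_op_one: "alg_op theta chi 1 v i j = v i j"
  using alg_op_single[of theta chi 0 1 v i j]
  by (simp_all add: gen_def scalar_def alg_op_single word_op_simps)

lemma alg_op_scalar_mult: "alg_op theta chi (scalar c * p) v i j = c * alg_op theta chi p v i j"
  by (simp add: alg_op_mult alg_op_scalar)

lemma alg_op_gen_mult: "alg_op theta chi (gen u * p) v i j = takiff_op theta chi u (alg_op theta chi p v) i j"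
  by (simp add: alg_op_mult alg_op_gen)

text \<open>
  The annihilator of the module, pulled back to the free algebra: there it is an ordinary ideal
  containing all relations, which shows that their ideal is proper.
\<close>
definition annihilator :: "complex \<Rightarrow> complex \<Rightarrow> takiff free_algebra set" where
  "annihilator theta chi = {p. \<forall>v i j. alg_op theta chi p v i j = 0}"

lemma ring_of_type_algebra_uminus: "\<ominus>\<^bsub>ring_of_type_algebra\<^esub> x = - (x :: 'a::ring_1)"
  by (rule abelian_group.minus_equality[OF ring.is_abelian_group[OF ring_ring_of_type_algebra]])
    (simp_all add: ring_of_type_algebra_def)

lemma ring_of_type_algebra_diff: "x \<ominus>\<^bsub>ring_of_type_algebra\<^esub> y = x - (y :: 'a::ring_1)"
  by (simp add: a_minus_def ring_of_type_algebra_uminus) (simp add: ring_of_type_algebra_def)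

lemma ideal_annihilator: "ideal (annihilator theta chi) ring_of_type_algebra"
proof (rule idealI[OF ring_ring_of_type_algebra])
  interpret R: ring "ring_of_type_algebra :: takiff free_algebra ring"
    by (rule ring_ring_of_type_algebra)
  show "subgroup (annihilator theta chi) (add_monoid ring_of_type_algebra)"
  proof (rule R.add.subgroupI)
    have "0 \<in> annihilator theta chi" by (simp add: annihilator_def alg_op_zero)
    then show "annihilator theta chi \<noteq> {}" by blast
    show "\<ominus>\<^bsub>ring_of_type_algebra\<^esub> p \<in> annihilator theta chi" if "p \<in> annihilator theta chi" for p
      using that unfolding ring_of_type_algebra_uminus by (simp add: annihilator_def alg_op_uminus)
  qed (simp_all add: annihilator_def ring_of_type_algebra_def alg_op_add)
  have zero: "alg_op theta chi p (\<lambda>_ _. 0) i j = 0" for p i j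
  proof -
    have "alg_op theta chi 0 v = (\<lambda>_ _. 0)" for v
      by (simp add: fun_eq_iff alg_op_zero)
    then show ?thesis using alg_op_mult[of theta chi p 0] by (metis mult_zero_right)
  qed
  fix p q :: "takiff free_algebra"
  assume p: "p \<in> annihilator theta chi"
  have "alg_op theta chi p v = (\<lambda>_ _. 0)" for v
    using p by (simp add: annihilator_def fun_eq_iff)
  then show "q \<otimes>\<^bsub>ring_of_type_algebra\<^esub> p \<in> annihilator theta chi"
    "p \<otimes>\<^bsub>ring_of_type_algebra\<^esub> q \<in> annihilator theta chi"
    by (auto simp: annihilator_def ring_of_type_algebra_def alg_op_mult zero)
qed

lemma enveloping_ideal_annihilator:
  "enveloping_ideal takiff_scale takiff_bracket \<subseteq> annihilator theta chi"
  unfolding enveloping_ideal_def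
proof (rule ring.genideal_minimal[OF ring_ring_of_type_algebra ideal_annihilator])
  have comp: "alg_op theta chi (gen u * gen w) v i j = takiff_op theta chi u (takiff_op theta chi w v) i j" for u w v i j
  proof -
    have "alg_op theta chi (gen w) v = takiff_op theta chi w v"
      by (simp add: fun_eq_iff alg_op_gen)
    then show ?thesis by (simp add: alg_op_mult alg_op_gen)
  qed
  show "enveloping_relations takiff_scale takiff_bracket \<subseteq> annihilator theta chi"
    unfolding enveloping_relations_def
    by (intro subsetI, elim UnE CollectE exE conjE)
      (simp_all add: annihilator_def alg_op_diff alg_op_gen takiff_op_add takiff_op_scale
        comp takiff_op_bracket alg_op_scalar_mult)
qed

lemma one_not_in_annihilator: "1 \<notin> annihilator theta chi"
proof
  assume "1 \<in> annihilator theta chi"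
  then have "alg_op theta chi 1 (\<lambda>_ _. 1) 0 0 = 0" by (simp add: annihilator_def)
  then show False by (simp add: alg_op_one)
qed

definition casimir_rep :: "takiff free_algebra" where
  "casimir_rep = gen (takiff_tensor sl2_h [:0, 1:]) * gen (takiff_tensor sl2_h 1)
     + 2 * gen (takiff_tensor sl2_f [:0, 1:]) * gen (takiff_tensor sl2_e 1)
     + 2 * gen (takiff_tensor sl2_e [:0, 1:]) * gen (takiff_tensor sl2_f 1)"

definition casimir_bar_rep :: "takiff free_algebra" where
  "casimir_bar_rep = gen (takiff_tensor sl2_h [:0, 1:]) ^ 2
     + 4 * gen (takiff_tensor sl2_f [:0, 1:]) * gen (takiff_tensor sl2_e [:0, 1:])"

lemma casimir_eq: "casimir = U_class casimir_rep" "casimir_bar = U_class casimir_bar_rep"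
  by (simp_all only: casimir_def casimir_bar_def casimir_rep_def casimir_bar_rep_def Let_def)

lemma casimir_annihilator:
  "casimir_rep - scalar theta \<in> annihilator theta chi"
  "casimir_bar_rep - scalar chi \<in> annihilator theta chi"
proof -
  have 2: "alg_op theta chi (2 * p) v i j = 2 * alg_op theta chi p v i j"
    and 4: "alg_op theta chi (4 * p) v i j = 4 * alg_op theta chi p v i j" for p v i j
  proof -
    have *: "alg_op theta chi (2 * p) v i j = 2 * alg_op theta chi p v i j" for p
      by (simp only: mult_2 alg_op_add)
    show "alg_op theta chi (2 * p) v i j = 2 * alg_op theta chi p v i j" by (rule *)
    have "alg_op theta chi (4 * p) v i j = alg_op theta chi (2 * (2 * p)) v i j" by simp
    also have "\<dots> = 4 * alg_op theta chi p v i j" unfolding * by simp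
    finally show "alg_op theta chi (4 * p) v i j = 4 * alg_op theta chi p v i j" .
  qed
  show "casimir_rep - scalar theta \<in> annihilator theta chi"
    unfolding annihilator_def casimir_rep_def mult.assoc
    by (simp add: alg_op_diff alg_op_add 2 alg_op_scalar alg_op_gen_mult alg_op_gen takiff_op_basis)
      (simp add: field_simps)
  show "casimir_bar_rep - scalar chi \<in> annihilator theta chi"
    unfolding annihilator_def casimir_bar_rep_def mult.assoc power2_eq_square
    by (simp add: alg_op_diff alg_op_add 4 alg_op_scalar alg_op_gen_mult alg_op_gen takiff_op_basis)
qed

section \<open>The enveloping algebra as a type\<close>

text \<open>
  The class of unital rings includes \<open>1 \<noteq> 0\<close>, which the representation above provides.
\<close>
lemma U_one_neq_zero: "\<one>\<^bsub>U_takiff\<^esub> \<noteq> \<zero>\<^bsub>U_takiff\<^esub>"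
proof
  interpret I: ideal "enveloping_ideal takiff_scale takiff_bracket" ring_of_type_algebra
    by (rule ideal_enveloping_ideal)
  assume "\<one>\<^bsub>U_takiff\<^esub> = \<zero>\<^bsub>U_takiff\<^esub>"
  then have "enveloping_ideal takiff_scale takiff_bracket +>\<^bsub>ring_of_type_algebra\<^esub> 1
      = enveloping_ideal takiff_scale takiff_bracket"
    by (simp add: enveloping_algebra_def FactRing_def ring_of_type_algebra_def)
  then have "1 \<in> enveloping_ideal takiff_scale takiff_bracket"
    using I.a_rcos_self[of 1] by (simp add: ring_of_type_algebra_def)
  then show False
    using enveloping_ideal_annihilator one_not_in_annihilator by blast
qed

interpretation U: ring U_takiff
  by (rule ring_enveloping_algebra)

text \<open>
  The arguments with generators and relations need equalities between elements of a type. The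
  parameters \<open>theta\<close> and \<open>chi\<close> are not part of it: they enter only through ideals of the enveloping
  algebra.
\<close>
typedef takiff_env = "carrier U_takiff" morphisms coset_of env_of_coset
  using U.zero_closed by blast

instantiation takiff_env :: ring_1
begin

definition zero_takiff_env :: takiff_env where "0 = env_of_coset \<zero>\<^bsub>U_takiff\<^esub>"
definition one_takiff_env :: takiff_env where "1 = env_of_coset \<one>\<^bsub>U_takiff\<^esub>"
definition plus_takiff_env :: "takiff_env \<Rightarrow> takiff_env \<Rightarrow> takiff_env" where
  "x + y = env_of_coset (coset_of x \<oplus>\<^bsub>U_takiff\<^esub> coset_of y)"
definition times_takiff_env :: "takiff_env \<Rightarrow> takiff_env \<Rightarrow> takiff_env" where
  "x * y = env_of_coset (coset_of x \<otimes>\<^bsub>U_takiff\<^esub> coset_of y)"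
definition uminus_takiff_env :: "takiff_env \<Rightarrow> takiff_env" where
  "- x = env_of_coset (\<ominus>\<^bsub>U_takiff\<^esub> coset_of x)"
definition minus_takiff_env :: "takiff_env \<Rightarrow> takiff_env \<Rightarrow> takiff_env" where
  "x - y = x + - y" for x y :: takiff_env

lemma coset_of_ops:
  "coset_of 0 = \<zero>\<^bsub>U_takiff\<^esub>" "coset_of 1 = \<one>\<^bsub>U_takiff\<^esub>"
  "coset_of (x + y) = coset_of x \<oplus>\<^bsub>U_takiff\<^esub> coset_of y"
  "coset_of (x * y) = coset_of x \<otimes>\<^bsub>U_takiff\<^esub> coset_of y"
  "coset_of (- x) = \<ominus>\<^bsub>U_takiff\<^esub> coset_of x"
  using coset_of[of x] coset_of[of y]
  by (simp_all add: zero_takiff_env_def one_takiff_env_def plus_takiff_env_def times_takiff_env_def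
      uminus_takiff_env_def env_of_coset_inverse)

instance
  by standard
    (simp_all add: coset_of_inject[symmetric] coset_of_ops minus_takiff_env_def coset_of U.m_assoc U.a_assoc
      U.l_distr U.r_distr U.l_neg U.r_neg U.a_comm U.a_lcomm U_one_neq_zero[symmetric])

end

definition env :: "takiff free_algebra \<Rightarrow> takiff_env" where
  "env p = env_of_coset (U_class p)"

lemma U_class_closed: "U_class p \<in> carrier U_takiff"
  using enveloping_class_ring_hom by (rule ring_hom_closed) (simp add: ring_of_type_algebra_def)

lemma coset_of_env: "coset_of (env p) = U_class p"
  by (simp add: env_def env_of_coset_inverse U_class_closed)

lemma U_class_ops:
  "U_class (p + q) = U_class p \<oplus>\<^bsub>U_takiff\<^esub> U_class q" "U_class (p * q) = U_class p \<otimes>\<^bsub>U_takiff\<^esub> U_class q"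
  "U_class 1 = \<one>\<^bsub>U_takiff\<^esub>"
  using ring_hom_add[OF enveloping_class_ring_hom, of p q takiff_scale takiff_bracket]
    ring_hom_mult[OF enveloping_class_ring_hom, of p q takiff_scale takiff_bracket]
    ring_hom_one[OF enveloping_class_ring_hom, of takiff_scale takiff_bracket]
  by (simp_all add: ring_of_type_algebra_def)

lemma env_add: "env (p + q) = env p + env q" and env_mult: "env (p * q) = env p * env q" and env_one: "env 1 = 1"
  by (simp_all add: coset_of_inject[symmetric] coset_of_env coset_of_ops U_class_ops)

lemma env_diff: "env (p - q) = env p - env q"
  using env_add[of "p - q" q] by simp

lemma env_surj: "\<exists>p. x = env p"
proof -
  have "\<exists>p. coset_of x = U_class p"
    using coset_of[of x]
    by (auto simp: enveloping_algebra_def enveloping_class_def FactRing_def A_RCOSETS_def' ring_of_type_algebra_def)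
  then show ?thesis by (simp add: coset_of_inject[symmetric] coset_of_env)
qed

lemma env_relation:
  assumes "p \<in> enveloping_relations takiff_scale takiff_bracket"
  shows "env p = 0"
proof -
  interpret I: ideal "enveloping_ideal takiff_scale takiff_bracket" ring_of_type_algebra
    by (rule ideal_enveloping_ideal)
  have "p \<in> enveloping_ideal takiff_scale takiff_bracket"
    using assms ring.genideal_self[OF ring_ring_of_type_algebra] 
    by (fastforce simp: enveloping_ideal_def ring_of_type_algebra_def)
  then have "U_class p = \<zero>\<^bsub>U_takiff\<^esub>"
    using I.a_rcos_const by (simp add: enveloping_class_def enveloping_algebra_def FactRing_def)
  then show ?thesis by (simp add: coset_of_inject[symmetric] coset_of_env coset_of_ops)
qed

abbreviation env_scalar :: "complex \<Rightarrow> takiff_env" where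
  "env_scalar c \<equiv> env (scalar c)"

abbreviation env_vec :: "takiff \<Rightarrow> takiff_env" where
  "env_vec u \<equiv> env (gen u)"

lemma env_vec_add: "env_vec (u + w) = env_vec u + env_vec w"
proof -
  have "gen (u + w) - gen u - gen w \<in> enveloping_relations takiff_scale takiff_bracket"
    unfolding enveloping_relations_def by blast
  from env_relation[OF this] show ?thesis by (simp add: env_diff env_add algebra_simps)
qed

lemma env_vec_scale: "env_vec (takiff_scale c u) = env_scalar c * env_vec u"
proof -
  have "gen (takiff_scale c u) - scalar c * gen u \<in> enveloping_relations takiff_scale takiff_bracket"
    unfolding enveloping_relations_def by blast
  from env_relation[OF this] show ?thesis by (simp add: env_diff env_mult)
qed

lemma env_vec_commutator: "env_vec u * env_vec w = env_vec w * env_vec u + env_vec (takiff_bracket u w)"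
proof -
  have "gen u * gen w - gen w * gen u - gen (takiff_bracket u w) \<in> enveloping_relations takiff_scale takiff_bracket"
    unfolding enveloping_relations_def by blast
  from env_relation[OF this] show ?thesis by (simp add: env_diff env_mult env_add algebra_simps)
qed

lemma env_scalar_central: "x * env_scalar c = env_scalar c * x"
  using env_surj[of x] by (auto simp: scalar_central simp flip: env_mult)

lemma env_induct:
  assumes "P 1" "\<And>x y. P x \<Longrightarrow> P y \<Longrightarrow> P (x + y)" "\<And>c x. P x \<Longrightarrow> P (env_scalar c * x)"
    and basis: "\<And>u x. u \<in> takiff_basis \<Longrightarrow> P x \<Longrightarrow> P (env_vec u * x)"
  shows "P x"
proof -
  obtain p where x: "x = env p" using env_surj by blast
  show ?thesis unfolding x
  proof (induction p rule: free_algebra_induct)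
    case (gen u p)
    then show ?case
      unfolding env_mult
    proof (induction u rule: takiff_induct[case_names add scale basis])
      case (add u w)
      then show ?case by (simp add: env_vec_add distrib_right assms(2))
    next
      case (scale c u)
      then show ?case by (simp add: env_vec_scale mult.assoc assms(3))
    qed (rule basis)
  qed (simp_all add: env_one env_add env_mult assms)
qed

abbreviation env_e :: takiff_env where "env_e \<equiv> env_vec (takiff_tensor sl2_e 1)"
abbreviation env_h :: takiff_env where "env_h \<equiv> env_vec (takiff_tensor sl2_h 1)"
abbreviation env_f :: takiff_env where "env_f \<equiv> env_vec (takiff_tensor sl2_f 1)"
abbreviation env_e_bar :: takiff_env where "env_e_bar \<equiv> env_vec (takiff_tensor sl2_e [:0, 1:])"
abbreviation env_h_bar :: takiff_env where "env_h_bar \<equiv> env_vec (takiff_tensor sl2_h [:0, 1:])"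
abbreviation env_f_bar :: takiff_env where "env_f_bar \<equiv> env_vec (takiff_tensor sl2_f [:0, 1:])"

interpretation takiff_env: takiff_algebra env_scalar env_e env_h env_f env_e_bar env_h_bar env_f_bar
proof
  show "env_scalar 1 = 1" "env_scalar (a + b) = env_scalar a + env_scalar b"
    "env_scalar (a * b) = env_scalar a * env_scalar b" for a b
    by (simp_all add: scalar_1 env_one scalar_add env_add scalar_mult env_mult)
  have sc_0: "env_scalar 0 = 0"
    using env_add[of 0 0] by (simp add: scalar_def)
  have sc_2: "env_scalar 2 = 2"
  proof -
    have "env_scalar (1 + 1) = 1 + 1"
      by (simp only: scalar_add env_add scalar_1 env_one)
    then show ?thesis by simp
  qed
  have sc_minus: "env_scalar (- c) = - env_scalar c" for c
    using env_add[of "scalar c" "scalar (- c)"] by (simp add: sc_0 flip: scalar_add) (simp add: eq_neg_iff_add_eq_0 add.commute)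
  have comm: "env_vec (takiff_tensor x p) * env_vec (takiff_tensor y q)
      = env_vec (takiff_tensor y q) * env_vec (takiff_tensor x p) + env_scalar c * env_vec (takiff_tensor z (p * q))"
    if "sl2_bracket x y = c *s z" for x y z p q c
    using env_vec_commutator[of "takiff_tensor x p" "takiff_tensor y q"] that
    by (simp add: takiff_bracket_tensor takiff_scale_tensor env_vec_scale)
  have br: "sl2_bracket sl2_e sl2_f = 1 *s sl2_h" "sl2_bracket sl2_e sl2_h = (- 2) *s sl2_e"
     "sl2_bracket sl2_e sl2_e = 0 *s sl2_e" "sl2_bracket sl2_f sl2_f = 0 *s sl2_f" "sl2_bracket sl2_h sl2_h = 0 *s sl2_h"
     "sl2_bracket sl2_f sl2_e = (- 1) *s sl2_h" "sl2_bracket sl2_f sl2_h = 2 *s sl2_f"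
    by (simp_all add: sl2_bracket_def sl2_e_def sl2_h_def sl2_f_def vec_eq_iff forall_3)
  have "takiff_tensor x [:0, 0, 1:] = takiff_scale 0 0" for x
    by (simp add: takiff_tensor_def takiff_scale_def zero_prod_def)
  then have zero: "env_vec (takiff_tensor x [:0, 0, 1:]) = 0" for x
    by (simp add: env_vec_scale sc_0)
  note comms = comm[OF br(1)] comm[OF br(2)] comm[OF br(3)] comm[OF br(4)] comm[OF br(5)] comm[OF br(6)] comm[OF br(7)]
    comm[OF sl2_bracket_basis(2)] comm[OF sl2_bracket_basis(3)]
  note sc = sc_0 sc_2 sc_minus scalar_1 env_one zero
  show "env_e * env_f = env_f * env_e + env_h"
    "env_h * env_e = env_e * env_h + 2 * env_e"
    "env_h * env_f = env_f * env_h - 2 * env_f"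
    "env_e * env_e_bar = env_e_bar * env_e"
    "env_e * env_h_bar = env_h_bar * env_e - 2 * env_e_bar"
    "env_e * env_f_bar = env_f_bar * env_e + env_h_bar"
    "env_h * env_e_bar = env_e_bar * env_h + 2 * env_e_bar"
    "env_h * env_h_bar = env_h_bar * env_h"
    "env_h * env_f_bar = env_f_bar * env_h - 2 * env_f_bar"
    "env_e_bar * env_f = env_f * env_e_bar + env_h_bar"
    "env_h_bar * env_f = env_f * env_h_bar - 2 * env_f_bar"
    "env_f_bar * env_f = env_f * env_f_bar"
    "env_h_bar * env_e_bar = env_e_bar * env_h_bar"
    "env_f_bar * env_e_bar = env_e_bar * env_f_bar"
    "env_f_bar * env_h_bar = env_h_bar * env_f_bar"
    using comms(1)[of 1 1] comms(8)[of 1 1] comms(9)[of 1 1] comms(3)[of 1 "[:0, 1:]"] comms(2)[of 1 "[:0, 1:]"]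
      comms(1)[of 1 "[:0, 1:]"] comms(8)[of 1 "[:0, 1:]"] comms(5)[of 1 "[:0, 1:]"] comms(9)[of 1 "[:0, 1:]"]
      comms(1)[of "[:0, 1:]" 1] comms(9)[of "[:0, 1:]" 1] comms(4)[of "[:0, 1:]" 1]
      comms(8)[of "[:0, 1:]" "[:0, 1:]"] comms(6)[of "[:0, 1:]" "[:0, 1:]"] comms(7)[of "[:0, 1:]" "[:0, 1:]"]
    by (simp_all add: sc)
  show "P x" if "P 1" "\<And>x y. P x \<Longrightarrow> P y \<Longrightarrow> P (x + y)" "\<And>c x. P x \<Longrightarrow> P (env_scalar c * x)"
    "\<And>g x. g \<in> {env_e, env_h, env_f, env_e_bar, env_h_bar, env_f_bar} \<Longrightarrow> P x \<Longrightarrow> P (g * x)" for P x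
    using that(1-3)
  proof (rule env_induct)
    fix u x assume "u \<in> takiff_basis" "P x"
    then show "P (env_vec u * x)"
      by (intro that(4)) (auto simp: takiff_basis_def)
  qed
qed (rule env_scalar_central)

section \<open>Maximality and simplicity\<close>

lemma env_casimir: "env casimir_rep = takiff_env.cas" "env casimir_bar_rep = takiff_env.cas_bar"
proof -
  have 2: "env 2 = 2" using env_add[of 1 1] by (simp add: env_one)
  have 4: "env 4 = 4" using env_add[of 2 2] by (simp add: 2)
  show "env casimir_rep = takiff_env.cas" "env casimir_bar_rep = takiff_env.cas_bar"
    by (simp_all add: casimir_rep_def casimir_bar_rep_def takiff_env.cas_def takiff_env.cas_bar_def
        env_add env_mult power2_eq_square 2 4)
qed

lemma simple_ring_Quot_maximal:
  assumes R: "ring R" and K: "ideal K R" and proper: "\<one>\<^bsub>R\<^esub> \<notin> K"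
    and max: "\<And>J. ideal J R \<Longrightarrow> K \<subseteq> J \<Longrightarrow> \<one>\<^bsub>R\<^esub> \<notin> J \<Longrightarrow> J \<subseteq> K"
  shows "simple_ring (R Quot K)"
  unfolding simple_ring_def
proof (intro conjI allI impI)
  interpret R: ring R by (rule R)
  interpret K: ideal K R by (rule K)
  show "ring (R Quot K)" by (rule K.quotient_is_ring)
  show "\<one>\<^bsub>R Quot K\<^esub> \<noteq> \<zero>\<^bsub>R Quot K\<^esub>"
    using K.a_rcos_self[of "\<one>\<^bsub>R\<^esub>"] proper by (auto simp: FactRing_def)
  fix I assume "ideal I (R Quot K)"
  then have "I \<in> (\<lambda>J. (+>\<^bsub>R\<^esub>) K ` J) ` {J. ideal J R \<and> K \<subseteq> J}"
    using R.quot_ideal_correspondence[OF K] by (simp add: bij_betw_def)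
  then obtain J where J: "ideal J R" "K \<subseteq> J" and I: "I = (+>\<^bsub>R\<^esub>) K ` J" by blast
  show "I = {\<zero>\<^bsub>R Quot K\<^esub>} \<or> I = carrier (R Quot K)"
  proof (cases "\<one>\<^bsub>R\<^esub> \<in> J")
    case True
    then have "J = carrier R" using J(1) by (rule ideal.one_imp_carrier[rotated])
    then show ?thesis using I by (auto simp: FactRing_def A_RCOSETS_def')
  next
    case False
    then have "J = K" using max J by blast
    moreover have "K \<noteq> {}"
      using additive_subgroup.zero_closed[OF K.additive_subgroup_axioms] by blast
    ultimately have "I = {K}"
      using I K.a_rcos_const by (auto simp: image_constant_conv)
    then show ?thesis by (simp add: FactRing_def)
  qed
qed

lemma two_sided_ideal_coset_of:
  assumes "ideal J U_takiff"
  shows "two_sided_ideal {x. coset_of x \<in> J}"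
proof -
  interpret ideal J U_takiff by (rule assms)
  show ?thesis
    unfolding two_sided_ideal_def left_ideal_def
    by (auto simp: coset_of_ops coset_of I_l_closed I_r_closed)
qed

theorem theorem4p1:
  fixes theta chi :: complex
  assumes "theta \<noteq> 0 \<or> chi \<noteq> 0"
  shows "simple_ring (U_takiff Quot
           (Idl\<^bsub>U_takiff\<^esub> {casimir \<ominus>\<^bsub>U_takiff\<^esub> U_class (scalar theta),
                            casimir_bar \<ominus>\<^bsub>U_takiff\<^esub> U_class (scalar chi)}))"
proof -
  have coset_diff: "U_class p \<ominus>\<^bsub>U_takiff\<^esub> U_class q = U_class (p - q)" for p q
  proof -
    have "U_class (p - q) = coset_of (env p + - env q)"
      by (simp only: coset_of_env[symmetric] env_diff minus_takiff_env_def)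
    then show ?thesis by (simp only: coset_of_ops coset_of_env a_minus_def)
  qed
  define gens where "gens = {U_class (casimir_rep - scalar theta), U_class (casimir_bar_rep - scalar chi)}"
  define K where "K = Idl\<^bsub>U_takiff\<^esub> gens"
  have gens: "gens \<subseteq> carrier U_takiff" by (simp add: gens_def U_class_closed)
  have K: "ideal K U_takiff" "gens \<subseteq> K"
    unfolding K_def using U.genideal_ideal[OF gens] U.genideal_self[OF gens] by blast+
  have proper: "\<one>\<^bsub>U_takiff\<^esub> \<notin> K"
  proof
    \<comment> \<open>The annihilator of the module of Laurent series is an ideal that contains both generators of \<open>K\<close>.\<close>
    define A where "A = U_class ` annihilator theta chi"
    have "ideal A U_takiff"
      using ring.ring_ideal_imp_quot_ideal[OF ring_ring_of_type_algebra ideal_enveloping_ideal ideal_annihilator]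
      unfolding A_def enveloping_algebra_def enveloping_class_def[abs_def] .
    moreover have "gens \<subseteq> A"
      unfolding gens_def A_def using casimir_annihilator by blast
    ultimately have "K \<subseteq> A" unfolding K_def by (rule U.genideal_minimal)
    moreover assume "\<one>\<^bsub>U_takiff\<^esub> \<in> K"
    ultimately obtain p where p: "p \<in> annihilator theta chi" "U_class 1 = U_class p"
      unfolding A_def by (auto simp: U_class_ops)
    have carrier: "q \<in> carrier ring_of_type_algebra" for q :: "takiff free_algebra"
      by (simp add: ring_of_type_algebra_def)
    have "1 \<ominus>\<^bsub>ring_of_type_algebra\<^esub> p \<in> enveloping_ideal takiff_scale takiff_bracket"
      by (simp only: ring.quotient_eq_iff_same_a_r_cos[OF ring_ring_of_type_algebra ideal_enveloping_ideal
            carrier carrier] p(2)[unfolded enveloping_class_def])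
    then have "1 \<ominus>\<^bsub>ring_of_type_algebra\<^esub> p \<in> annihilator theta chi"
      using enveloping_ideal_annihilator by blast
    then have "1 \<in> annihilator theta chi"
      using p(1) by (simp add: ring_of_type_algebra_diff annihilator_def alg_op_diff)
    then show False using one_not_in_annihilator by blast
  qed
  have "simple_ring (U_takiff Quot K)"
  proof (rule simple_ring_Quot_maximal[OF U.ring_axioms K(1) proper])
    fix J assume J: "ideal J U_takiff" "K \<subseteq> J" "\<one>\<^bsub>U_takiff\<^esub> \<notin> J"
    have "{x. coset_of x \<in> J} \<subseteq> {x. coset_of x \<in> K}"
    proof (rule takiff_env.proper_ideal_subset[OF assms])
      show "takiff_env.cas - env_scalar theta \<in> {x. coset_of x \<in> K}"
        "takiff_env.cas_bar - env_scalar chi \<in> {x. coset_of x \<in> K}"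
        using K(2) by (simp_all add: gens_def coset_of_env flip: env_casimir env_diff)
    qed (use J K in \<open>auto simp: two_sided_ideal_coset_of coset_of_ops\<close>)
    moreover have "x \<in> coset_of ` {x. coset_of x \<in> J}" if "x \<in> J" for x
      using that ideal.Icarr[OF J(1) that] by (auto intro: image_eqI[of _ _ "env_of_coset x"] simp: env_of_coset_inverse)
    ultimately show "J \<subseteq> K" by blast
  qed
  then show ?thesis
    by (simp add: K_def gens_def casimir_eq coset_diff)
qed

end
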